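(* A probabilistic automaton $\mathcal{A}$ is leaktight if and only if its extended Markov monoid does not contain any leak witness.
   Context: Fix a finite alphabet $A$ and a probabilistic automaton $\mathcal{A}=(Q,q_0,\Delta,F)$, $\Delta:Q\times A\to\mathcal{D}(Q)$. For $a\in A$ let $M_a(s,t)=\Delta(s,a)(t)$, for $u=a_0\cdots a_{n-1}$ let $M_u=M_{a_0}\cdots M_{a_{n-1}}$ (identity for the empty word), and $\mathbb{P}_{\mathcal{A}}(s\xrightarrow{u}t)=M_u(s,t)$. A nonnegative $Q\times Q$ matrix $M$ is idempotent if $M(s,t)>0\iff M^2(s,t)>0$ for all $s,t$; a word $u$ is idempotent if $M_u$ is. A leak is a sequence $(u_n)$ of idempotent words such that $M_{u_n}$ converges to an idempotent matrix $M$ and there exist states $r,q$, both recurrent in the Markov chain with transition matrix $M$, with $\lim_n\mathbb{P}_{\mathcal{A}}(r\xrightarrow{u_n}q)=0$ and $\mathbb{P}_{\mathcal{A}}(r\xrightarrow{u_n}q)>0$ for all $n$; $\mathcal{A}$ is leaktight if it has no leak. A limit-word is a map $\mathbf{u}:Q\times Q\to\{0,1\}$ such that every $s$ has some $t$ with $\mathbf{u}(s,t)=1$. Concatenation: $(\mathbf{u}\cdot\mathbf{v})(s,t)=1$ iff there is $q$ with $\mathbf{u}(s,q)=\mathbf{v}(q,t)=1$. $\mathbf{u}$ is idempotent if $\mathbf{u}\cdot\mathbf{u}=\mathbf{u}$; for idempotent $\mathbf{u}$, $s$ is $\mathbf{u}$-recurrent if for all $t$, $\mathbf{u}(s,t)=1\Rightarrow\mathbf{u}(t,s)=1$,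 and $\mathbf{u}^\sharp(s,t)=1$ iff $\mathbf{u}(s,t)=1$ and $t$ is $\mathbf{u}$-recurrent. For $a\in A$, $\mathbf{a}(s,t)=1$ iff $\Delta(s,a)(t)>0$; $\mathbf{1}$ is the identity. An extended limit-word is a pair $(\mathbf{u},\mathbf{u}_+)$ of limit-words with $\mathbf{u}\le\mathbf{u}_+$ pointwise; concatenation is componentwise, $(\mathbf{u},\mathbf{u}_+)$ is idempotent if both components are, and then $(\mathbf{u},\mathbf{u}_+)^\sharp=(\mathbf{u}^\sharp,\mathbf{u}_+)$. The extended Markov monoid is the smallest set of extended limit-words containing $\{(\mathbf{a},\mathbf{a})\mid a\in A\}\cup\{(\mathbf{1},\mathbf{1})\}$ and closed under concatenation and iteration of idempotents. A leak witness is an idempotent extended limit-word $(\mathbf{u},\mathbf{u}_+)$ for which there exist states $r,q$ that are both $\mathbf{u}$-recurrent with $\mathbf{u}(r,q)=0$ and $\mathbf{u}_+(r,q)=1$. *)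

theory Defs
  imports "HOL-Probability.Probability_Mass_Function"
begin

text \<open>A probabilistic automaton over a finite alphabet 'a with finite state set 'q.
  Only the transition function matters for leaktightness; it is given as
  Delta :: 'q => 'a => 'q pmf, i.e. Delta s a is a probability distribution on Q.\<close>

type_synonym 'q mat = "'q \<Rightarrow> 'q \<Rightarrow> real"

definition mat_mult :: "('q::finite) mat \<Rightarrow> 'q mat \<Rightarrow> 'q mat" where
  "mat_mult M N = (\<lambda>s t. \<Sum>q\<in>UNIV. M s q * N q t)"

definition mat_one :: "'q mat" where
  "mat_one = (\<lambda>s t. if s = t then 1 else 0)"

definition mat_letter :: "('q \<Rightarrow> 'a \<Rightarrow> 'q pmf) \<Rightarrow> 'a \<Rightarrow> 'q mat" where
  "mat_letter Delta a = (\<lambda>s t. pmf (Delta s a) t)"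

definition mat_word :: "('q::finite \<Rightarrow> 'a \<Rightarrow> 'q pmf) \<Rightarrow> 'a list \<Rightarrow> 'q mat" where
  "mat_word Delta u = foldr (\<lambda>a M. mat_mult (mat_letter Delta a) M) u mat_one"

definition prob_path :: "('q::finite \<Rightarrow> 'a \<Rightarrow> 'q pmf) \<Rightarrow> 'q \<Rightarrow> 'a list \<Rightarrow> 'q \<Rightarrow> real" where
  "prob_path Delta s u t = mat_word Delta u s t"

definition idempotent_mat :: "('q::finite) mat \<Rightarrow> bool" where
  "idempotent_mat M \<longleftrightarrow> (\<forall>s t. M s t > 0 \<longleftrightarrow> mat_mult M M s t > 0)"

definition idempotent_word :: "('q::finite \<Rightarrow> 'a \<Rightarrow> 'q pmf) \<Rightarrow> 'a list \<Rightarrow> bool" where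
  "idempotent_word Delta u \<longleftrightarrow> idempotent_mat (mat_word Delta u)"

definition mc_reach :: "'q mat \<Rightarrow> ('q \<times> 'q) set" where
  "mc_reach M = {(s, t). M s t > 0}\<^sup>*"

definition mc_recurrent :: "'q mat \<Rightarrow> 'q \<Rightarrow> bool" where
  "mc_recurrent M s \<longleftrightarrow> (\<forall>t. (s, t) \<in> mc_reach M \<longrightarrow> (t, s) \<in> mc_reach M)"

definition mat_tendsto :: "(nat \<Rightarrow> 'q mat) \<Rightarrow> 'q mat \<Rightarrow> bool" where
  "mat_tendsto Ms M \<longleftrightarrow> (\<forall>s t. (\<lambda>n. Ms n s t) \<longlonglongrightarrow> M s t)"

definition is_leak :: "('q::finite \<Rightarrow> 'a \<Rightarrow> 'q pmf) \<Rightarrow> (nat \<Rightarrow> 'a list) \<Rightarrow> bool" where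
  "is_leak Delta us \<longleftrightarrow>
     (\<forall>n. idempotent_word Delta (us n)) \<and>
     (\<exists>M. mat_tendsto (\<lambda>n. mat_word Delta (us n)) M \<and> idempotent_mat M \<and>
        (\<exists>r q. mc_recurrent M r \<and> mc_recurrent M q \<and>
           (\<lambda>n. prob_path Delta r (us n) q) \<longlonglongrightarrow> 0 \<and>
           (\<forall>n. prob_path Delta r (us n) q > 0)))"

definition leaktight :: "('q::finite \<Rightarrow> 'a \<Rightarrow> 'q pmf) \<Rightarrow> bool" where
  "leaktight Delta \<longleftrightarrow> \<not> (\<exists>us. is_leak Delta us)"

type_synonym 'q lword = "'q \<Rightarrow> 'q \<Rightarrow> bool"

definition is_limit_word :: "'q lword \<Rightarrow> bool" where
  "is_limit_word u \<longleftrightarrow> (\<forall>s. \<exists>t. u s t)"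

definition lw_mult :: "'q lword \<Rightarrow> 'q lword \<Rightarrow> 'q lword" where
  "lw_mult u v = (\<lambda>s t. \<exists>q. u s q \<and> v q t)"

definition lw_idempotent :: "'q lword \<Rightarrow> bool" where
  "lw_idempotent u \<longleftrightarrow> lw_mult u u = u"

definition lw_recurrent :: "'q lword \<Rightarrow> 'q \<Rightarrow> bool" where
  "lw_recurrent u s \<longleftrightarrow> (\<forall>t. u s t \<longrightarrow> u t s)"

definition lw_sharp :: "'q lword \<Rightarrow> 'q lword" where
  "lw_sharp u = (\<lambda>s t. u s t \<and> lw_recurrent u t)"

definition lw_letter :: "('q \<Rightarrow> 'a \<Rightarrow> 'q pmf) \<Rightarrow> 'a \<Rightarrow> 'q lword" where
  "lw_letter Delta a = (\<lambda>s t. pmf (Delta s a) t > 0)"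

definition lw_one :: "'q lword" where
  "lw_one = (\<lambda>s t. s = t)"

definition is_ext_limit_word :: "'q lword \<times> 'q lword \<Rightarrow> bool" where
  "is_ext_limit_word w \<longleftrightarrow> is_limit_word (fst w) \<and> is_limit_word (snd w) \<and> fst w \<le> snd w"

definition elw_mult :: "'q lword \<times> 'q lword \<Rightarrow> 'q lword \<times> 'q lword \<Rightarrow> 'q lword \<times> 'q lword" where
  "elw_mult w v = (lw_mult (fst w) (fst v), lw_mult (snd w) (snd v))"

definition elw_idempotent :: "'q lword \<times> 'q lword \<Rightarrow> bool" where
  "elw_idempotent w \<longleftrightarrow> lw_idempotent (fst w) \<and> lw_idempotent (snd w)"

definition elw_sharp :: "'q lword \<times> 'q lword \<Rightarrow> 'q lword \<times> 'q lword" where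
  "elw_sharp w = (lw_sharp (fst w), snd w)"

inductive_set ext_markov_monoid :: "('q \<Rightarrow> 'a \<Rightarrow> 'q pmf) \<Rightarrow> ('q lword \<times> 'q lword) set"
  for Delta :: "'q \<Rightarrow> 'a \<Rightarrow> 'q pmf" where
  letter: "(lw_letter Delta a, lw_letter Delta a) \<in> ext_markov_monoid Delta"
| one: "(lw_one, lw_one) \<in> ext_markov_monoid Delta"
| mult: "w \<in> ext_markov_monoid Delta \<Longrightarrow> v \<in> ext_markov_monoid Delta \<Longrightarrow>
           elw_mult w v \<in> ext_markov_monoid Delta"
| iter: "w \<in> ext_markov_monoid Delta \<Longrightarrow> elw_idempotent w \<Longrightarrow>
           elw_sharp w \<in> ext_markov_monoid Delta"

definition leak_witness :: "'q lword \<times> 'q lword \<Rightarrow> bool" where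
  "leak_witness w \<longleftrightarrow> is_ext_limit_word w \<and> elw_idempotent w \<and>
     (\<exists>r q. lw_recurrent (fst w) r \<and> lw_recurrent (fst w) q \<and>
            \<not> fst w r q \<and> snd w r q)"

end

(* From a leak to a witness. Without a leak witness, the words can be covered by finitely many
   languages W_x, with x in the extended Markov monoid, such that all words of W_x have support snd x
   and probability at least some c > 0 on fst x. This replaces factorization forests: by induction
   on the size of two-sided ideals, coverability is preserved by W -> W^+. Within one J-class it is
   Kleene's construction on the right multiplication automaton; the loops at a state k have values
   in {g. k g = k}, a band with x y = x, so that their iteration reduces to iterating single
   idempotents e, for which either e# = e or e# generates a smaller ideal. Along a leak some element
   x of the monoid occurs infinitely often; an idempotent power of x is a witness, after the two
   recurrent states of the leak are moved inside their classes.

   From a witness to a leak. For each x of the monoid there is c > 0 such that, for every epsilon > 0,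
   some word with support snd x has probabilities at least c on fst x and at most epsilon elsewhere;
   for e# one takes a high power of a word for e with much smaller error. A convergent subsequence
   of such words for a witness is a leak. *)

theory Submission
  imports Defs
begin

section \<open>Languages\<close>

definition conc :: "'a list set \<Rightarrow> 'a list set \<Rightarrow> 'a list set" where
  "conc V W = {v @ w | v w. v \<in> V \<and> w \<in> W}"

text \<open>Nonempty iteration: the empty word has the identity as support, so it could not be
  bounded by an arbitrary idempotent.\<close>

inductive_set kplus :: "'a list set \<Rightarrow> 'a list set" for W where
  base: "w \<in> W \<Longrightarrow> w \<in> kplus W"
| snoc: "v \<in> kplus W \<Longrightarrow> w \<in> W \<Longrightarrow> v @ w \<in> kplus W"

lemma concI: "v \<in> V \<Longrightarrow> w \<in> W \<Longrightarrow> v @ w \<in> conc V W"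
  unfolding conc_def by blast

lemma concE: "x \<in> conc V W \<Longrightarrow> (\<And>v w. x = v @ w \<Longrightarrow> v \<in> V \<Longrightarrow> w \<in> W \<Longrightarrow> P) \<Longrightarrow> P"
  unfolding conc_def by blast

lemma conc_mono: "V \<subseteq> V' \<Longrightarrow> W \<subseteq> W' \<Longrightarrow> conc V W \<subseteq> conc V' W'"
  unfolding conc_def by blast

lemma kplus_mono: "V \<subseteq> W \<Longrightarrow> kplus V \<subseteq> kplus W"
proof
  fix x assume "V \<subseteq> W" "x \<in> kplus V"
  from this(2,1) show "x \<in> kplus W" by induction (auto intro: kplus.intros)
qed

lemma kplus_empty: "kplus {} = {}"
  by (auto elim: kplus.cases)

text \<open>Cut a word just before each block taken from \<open>D\<close>: every piece is a block of
  \<open>D\<close> with a possibly empty tail of \<open>V\<close>-blocks, hence in \<open>X\<close>,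
  and only \<open>V\<close>-blocks precede the first cut.\<close>

lemma kplus_Un_subset:
  fixes V D :: "'a list set"
  defines "X \<equiv> D \<union> conc D (kplus V)"
  shows "kplus (V \<union> D) \<subseteq> kplus V \<union> kplus X \<union> conc (kplus V) (kplus X)"
proof
  have absorb: "v @ w \<in> kplus X" if "v \<in> kplus X" "w \<in> V" for v w
  proof -
    have X: "x @ w \<in> X" if xX: "x \<in> X" for x
    proof (cases "x \<in> D")
      case True then show ?thesis unfolding X_def
        using \<open>w \<in> V\<close> by (auto intro: concI kplus.intros)
    next
      case False
      then obtain d p where "x = d @ p" "d \<in> D" "p \<in> kplus V"
        using xX unfolding X_def by (auto elim!: concE)
      then show ?thesis unfolding X_def
        using concI[of d D "p @ w" "kplus V"] \<open>w \<in> V\<close> by (auto intro: kplus.intros)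
    qed
    from \<open>v \<in> kplus X\<close> show ?thesis
    proof cases
      case base then show ?thesis using X by (auto intro: kplus.intros)
    next
      case (snoc v' x) then show ?thesis using X kplus.snoc[of v' X "x @ w"] by simp
    qed
  qed
  have DX: "D \<subseteq> X" unfolding X_def by blast
  fix x assume "x \<in> kplus (V \<union> D)"
  then show "x \<in> kplus V \<union> kplus X \<union> conc (kplus V) (kplus X)"
  proof induction
    case (base w) then show ?case using DX by (auto intro: kplus.intros)
  next
    case (snoc v w)
    show ?case
    proof (cases "w \<in> V")
      case True
      from snoc.IH consider "v \<in> kplus V" | "v \<in> kplus X" | "v \<in> conc (kplus V) (kplus X)" by blast
      then show ?thesis
      proof cases
        case 1 then show ?thesis using True by (auto intro: kplus.intros)
      next
        case 2 then show ?thesis using absorb True by blast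
      next
        case 3
        then obtain a b where "v = a @ b" "a \<in> kplus V" "b \<in> kplus X" by (auto elim: concE)
        then show ?thesis using absorb[OF _ True, of b] concI[of a _ "b @ w"] by simp
      qed
    next
      case False
      then have w: "w \<in> X" using snoc DX by blast
      from snoc.IH consider "v \<in> kplus V" | "v \<in> kplus X" | "v \<in> conc (kplus V) (kplus X)" by blast
      then show ?thesis
      proof cases
        case 1 then show ?thesis using w by (auto intro: kplus.intros concI)
      next
        case 2 then show ?thesis using w by (auto intro: kplus.intros)
      next
        case 3
        then obtain a b where "v = a @ b" "a \<in> kplus V" "b \<in> kplus X" by (auto elim: concE)
        then show ?thesis using w kplus.snoc[of b X w] concI[of a _ "b @ w"] by simp
      qed
    qed
  qed
qed

section \<open>Covering by bounded languages in a finite stabilisation monoid\<close>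

text \<open>The predicate \<open>bd W x\<close> stands for ``the words of \<open>W\<close> are uniformly bounded by \<open>x\<close>''.\<close>

locale stabilisation_cover =
  fixes mul :: "'g::finite \<Rightarrow> 'g \<Rightarrow> 'g" (infixl "\<cdot>" 70)
    and one :: 'g
    and sharp :: "'g \<Rightarrow> 'g"
    and bd :: "'a list set \<Rightarrow> 'g \<Rightarrow> bool"
  assumes mul_assoc: "(x \<cdot> y) \<cdot> z = x \<cdot> (y \<cdot> z)"
    and one_left: "one \<cdot> x = x"
    and one_right: "x \<cdot> one = x"
    and sharp_left: "e \<cdot> e = e \<Longrightarrow> e \<cdot> sharp e = sharp e"
    and sharp_right: "e \<cdot> e = e \<Longrightarrow> sharp e \<cdot> e = sharp e"
    and sharp_idem: "e \<cdot> e = e \<Longrightarrow> sharp e \<cdot> sharp e = sharp e"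
    and bd_empty: "bd {} x"
    and bd_mono: "V \<subseteq> W \<Longrightarrow> bd W x \<Longrightarrow> bd V x"
    and bd_Un: "bd V x \<Longrightarrow> bd W x \<Longrightarrow> bd (V \<union> W) x"
    and bd_conc: "bd V x \<Longrightarrow> bd W y \<Longrightarrow> bd (conc V W) (x \<cdot> y)"
    and bd_plus: "bd W e \<Longrightarrow> e \<cdot> e = e \<Longrightarrow> bd (kplus W) (sharp e)"
begin

section \<open>Coverings by finitely many bounded languages\<close>

definition cov :: "'g set \<Rightarrow> 'a list set \<Rightarrow> bool" where
  "cov R W \<longleftrightarrow> (\<exists>U. (\<forall>g. bd (U g) g) \<and> W \<subseteq> (\<Union>g\<in>R. U g))"

lemma cov_mono: "cov R V \<Longrightarrow> R \<subseteq> S \<Longrightarrow> W \<subseteq> V \<Longrightarrow> cov S W"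
  unfolding cov_def by (meson UN_mono order_trans subset_refl)

lemma cov_bd: "bd W g \<Longrightarrow> g \<in> R \<Longrightarrow> cov R W"
  unfolding cov_def by (rule exI[of _ "\<lambda>h. if h = g then W else {}"]) (auto simp: bd_empty)

lemma cov_empty: "cov R {}"
  unfolding cov_def using bd_empty by (intro exI[of _ "\<lambda>_. {}"]) auto

lemma cov_Un: "cov R V \<Longrightarrow> cov R W \<Longrightarrow> cov R (V \<union> W)"
proof -
  assume "cov R V" "cov R W"
  then obtain A B where "\<forall>g. bd (A g) g" "V \<subseteq> (\<Union>g\<in>R. A g)" "\<forall>g. bd (B g) g" "W \<subseteq> (\<Union>g\<in>R. B g)"
    unfolding cov_def by blast
  then show ?thesis unfolding cov_def
    by (intro exI[of _ "\<lambda>g. A g \<union> B g"]) (auto intro: bd_Un)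
qed

lemma cov_UN: "finite I \<Longrightarrow> (\<And>i. i \<in> I \<Longrightarrow> cov R (U i)) \<Longrightarrow> cov R (\<Union>i\<in>I. U i)"
  by (induction I rule: finite_induct) (auto intro: cov_Un cov_empty)

lemma cov_conc:
  assumes "cov R V" "cov S W" and RS: "\<And>r s. r \<in> R \<Longrightarrow> s \<in> S \<Longrightarrow> r \<cdot> s \<in> Q"
  shows "cov Q (conc V W)"
proof -
  obtain A B where A: "\<And>g. bd (A g) g" "V \<subseteq> (\<Union>g\<in>R. A g)"
    and B: "\<And>g. bd (B g) g" "W \<subseteq> (\<Union>g\<in>S. B g)"
    using assms(1,2) unfolding cov_def by blast
  have "cov Q (\<Union>(r,s)\<in>R\<times>S. conc (A r) (B s))"
    by (rule cov_UN) (auto intro: cov_bd bd_conc A B RS)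
  moreover have "conc V W \<subseteq> (\<Union>(r,s)\<in>R\<times>S. conc (A r) (B s))"
    using A(2) B(2) unfolding conc_def by fastforce
  ultimately show ?thesis by (rule cov_mono[OF _ subset_refl])
qed

lemma cov_split:
  assumes "cov (R \<union> S) W"
  obtains V D where "W = V \<union> D" "cov R V" "cov S D"
proof -
  obtain U where U: "\<forall>g. bd (U g) g" "W \<subseteq> (\<Union>g\<in>R\<union>S. U g)" using assms unfolding cov_def by blast
  have "cov R (W \<inter> (\<Union>g\<in>R. U g))" "cov S (W \<inter> (\<Union>g\<in>S. U g))" unfolding cov_def using U by blast+
  moreover have "W = (W \<inter> (\<Union>g\<in>R. U g)) \<union> (W \<inter> (\<Union>g\<in>S. U g))" using U by blast
  ultimately show ?thesis using that by blast
qed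

lemma bd_if_cov_singleton: "cov {g} W \<Longrightarrow> bd W g"
  unfolding cov_def by (auto intro: bd_mono)

section \<open>Two-sided ideals, rank and stability\<close>

definition ideal :: "'g \<Rightarrow> 'g set" where
  "ideal x = {a \<cdot> x \<cdot> b | a b. True}"

text \<open>A numerical stand-in for the J-order: a product never exceeds the rank of a factor, and
  nested ideals of equal rank coincide.\<close>

definition rank :: "'g \<Rightarrow> nat" where
  "rank x = card (ideal x)"

lemma ideal_self: "x \<in> ideal x"
  unfolding ideal_def by (metis (mono_tags, lifting) mem_Collect_eq one_left one_right)

lemma ideal_mul_left: "ideal (x \<cdot> y) \<subseteq> ideal x"
  unfolding ideal_def by (auto simp: mul_assoc)

lemma ideal_mul_right: "ideal (x \<cdot> y) \<subseteq> ideal y"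
  unfolding ideal_def by (auto simp: mul_assoc) (metis mul_assoc)

lemma rank_mul_left: "rank (x \<cdot> y) \<le> rank x"
  unfolding rank_def by (intro card_mono ideal_mul_left) auto

lemma rank_mul_right: "rank (x \<cdot> y) \<le> rank y"
  unfolding rank_def by (intro card_mono ideal_mul_right) auto

definition pow :: "'g \<Rightarrow> nat \<Rightarrow> 'g" where
  "pow x i = ((\<lambda>y. y \<cdot> x) ^^ i) one"

lemma pow_0: "pow x 0 = one" and pow_Suc: "pow x (Suc i) = pow x i \<cdot> x"
  unfolding pow_def by auto

lemma pow_add: "pow x (i + j) = pow x i \<cdot> pow x j"
  by (induction j) (auto simp: pow_0 pow_Suc one_right mul_assoc)

text \<open>Since \<open>k\<close> and \<open>g\<close> generate the same two-sided ideal, \<open>g = a k b = y\<^sup>i g b\<^sup>i\<close> with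
  \<open>y = a k\<close>. Two powers of \<open>y\<close> coincide, which removes the factors \<open>b\<close>.\<close>

lemma stability:
  assumes kg: "k \<cdot> g = k" and rank: "rank g = rank k"
  shows "\<exists>c. g = c \<cdot> k"
proof -
  have "ideal k \<subseteq> ideal g" using ideal_mul_right[of k g] kg by simp
  then have "ideal g = ideal k" using rank unfolding rank_def by (metis card_subset_eq finite)
  then obtain a b where g: "g = a \<cdot> k \<cdot> b" using ideal_self[of g] unfolding ideal_def by auto
  define y where "y = a \<cdot> k"
  have yg: "y \<cdot> g = y" unfolding y_def using kg by (simp add: mul_assoc)
  have step: "g = y \<cdot> g \<cdot> b" using g yg y_def by simp
  have it: "g = pow y i \<cdot> g \<cdot> pow b i" for i
  proof (induction i)
    case 0 then show ?case by (simp add: pow_0 one_left one_right)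
  next
    case (Suc i)
    have "pow y i \<cdot> g \<cdot> pow b i = pow y i \<cdot> (y \<cdot> g \<cdot> b) \<cdot> pow b i" using step by simp
    also have "\<dots> = pow y (Suc i) \<cdot> g \<cdot> (pow b 1 \<cdot> pow b i)"
      by (simp add: pow_Suc pow_0 one_left mul_assoc)
    also have "pow b 1 \<cdot> pow b i = pow b (Suc i)" using pow_add[of b 1 i] by simp
    finally show ?case using Suc by simp
  qed
  have "\<not> inj (pow y)" using finite_imageD[of "pow y" UNIV] by auto
  then obtain i j where ij: "i < j" "pow y i = pow y j" unfolding inj_def by (metis nat_neq_iff)
  obtain d where d: "j = Suc d + i" using ij(1) by (metis add_Suc less_natE add.commute)
  have "pow y i = pow y (Suc d) \<cdot> pow y i" using ij(2) unfolding d pow_add .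
  then have "g = pow y (Suc d) \<cdot> (pow y i \<cdot> g \<cdot> pow b i)"
    using it[of i] by (metis mul_assoc)
  then have "g = pow y (Suc d) \<cdot> g" using it[of i] by simp
  also have "\<dots> = pow y d \<cdot> a \<cdot> k" using yg by (simp add: pow_Suc mul_assoc y_def)
  finally show ?thesis by blast
qed

text \<open>Stability gives \<open>x = c \<cdot> k\<close>, so a further factor that fixes
  \<open>k\<close> is absorbed. The elements that fix \<open>k\<close> and have its rank therefore
  form a left-zero band.\<close>

lemma stabiliser_band:
  assumes "k \<cdot> x = k" "rank x = rank k" "k \<cdot> y = k"
  shows "x \<cdot> y = x"
  using stability[OF assms(1,2)] assms(3) by (metis mul_assoc)

text \<open>If the ranks agree, stability yields \<open>e = c \<cdot> sharp e\<close>. Multiplying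
  by \<open>sharp e\<close> on the right leaves \<open>e\<close> unchanged, yet the same product is
  \<open>sharp e\<close>.\<close>

lemma sharp_eq_or_rank_less:
  assumes e: "e \<cdot> e = e"
  shows "sharp e = e \<or> rank (sharp e) < rank e"
proof (cases "rank (sharp e) = rank e")
  case True
  then obtain c where "e = c \<cdot> sharp e" using stability[of "sharp e" e] sharp_right[OF e] by auto
  then have "e \<cdot> sharp e = e" using sharp_idem[OF e] by (metis mul_assoc)
  then show ?thesis using sharp_left[OF e] by simp
next
  case False
  then show ?thesis using rank_mul_left[of e "sharp e"] sharp_left[OF e] by simp
qed

text \<open>Runs of the right multiplication automaton on the monoid: \<open>path U T K p w q\<close> reads a word \<open>w\<close>
  factored into blocks from \<open>U g\<close> with \<open>g \<in> T\<close>, from state \<open>p\<close> to \<open>q\<close>, all intermediate states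
  being in \<open>K\<close>.\<close>

inductive path :: "('g \<Rightarrow> 'a list set) \<Rightarrow> 'g set \<Rightarrow> 'g set \<Rightarrow> 'g \<Rightarrow> 'a list \<Rightarrow> 'g \<Rightarrow> bool"
  for U T K p where
  base: "g \<in> T \<Longrightarrow> w \<in> U g \<Longrightarrow> path U T K p w (p \<cdot> g)"
| snoc: "path U T K p w k \<Longrightarrow> k \<in> K \<Longrightarrow> g \<in> T \<Longrightarrow> u \<in> U g \<Longrightarrow> path U T K p (w @ u) (k \<cdot> g)"

definition paths where "paths U T K p q = {w. path U T K p w q}"

text \<open>Kleene's decomposition of a run at its visits to \<open>k\<close>. A single visit and
  repeated visits are separate terms because \<open>kplus\<close> has no empty iteration.\<close>

lemma paths_insert:
  "paths U T (insert k K) p q \<subseteq> paths U T K p q \<union> conc (paths U T K p k) (paths U T K k q)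
     \<union> conc (conc (paths U T K p k) (kplus (paths U T K k k))) (paths U T K k q)"
proof
  let ?P = "paths U T K"
  fix w assume "w \<in> paths U T (insert k K) p q"
  then have "path U T (insert k K) p w q" unfolding paths_def by simp
  then show "w \<in> ?P p q \<union> conc (?P p k) (?P k q)
     \<union> conc (conc (?P p k) (kplus (?P k k))) (?P k q)"
  proof induction
    case (base g w)
    then show ?case unfolding paths_def by (auto intro: path.base)
  next
    case (snoc w l g u)
    have last: "u \<in> ?P l (l \<cdot> g)" using snoc unfolding paths_def by (auto intro: path.base)
    have ext: "v @ u \<in> ?P x (l \<cdot> g)" if "v \<in> ?P x l" "l \<in> K" for v x
      using that snoc unfolding paths_def by (auto intro: path.snoc)
    show ?case
    proof (cases "l = k")
      case True
      have "w \<in> ?P p k \<union> conc (?P p k) (kplus (?P k k))"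
      proof -
        have "conc (conc (?P p k) (kplus (?P k k))) (?P k k) \<subseteq> conc (?P p k) (kplus (?P k k))"
        proof
          fix x assume "x \<in> conc (conc (?P p k) (kplus (?P k k))) (?P k k)"
          then obtain a b c where "x = a @ (b @ c)" "a \<in> ?P p k" "b \<in> kplus (?P k k)" "c \<in> ?P k k"
            by (auto elim!: concE)
          then show "x \<in> conc (?P p k) (kplus (?P k k))" by (auto intro!: concI kplus.snoc)
        qed
        moreover have "conc (?P p k) (?P k k) \<subseteq> conc (?P p k) (kplus (?P k k))"
          by (intro conc_mono) (auto intro: kplus.base)
        ultimately show ?thesis using snoc.IH True by blast
      qed
      then show ?thesis using last True by (auto intro: concI)
    next
      case False
      then have l: "l \<in> K" using snoc by blast
      from snoc.IH consider "w \<in> ?P p l" | "w \<in> conc (?P p k) (?P k l)"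
        | "w \<in> conc (conc (?P p k) (kplus (?P k k))) (?P k l)" by blast
      then show ?thesis
      proof cases
        case 1 then show ?thesis using ext[OF _ l] by blast
      next
        case 2
        then obtain a b where "w = a @ b" "a \<in> ?P p k" "b \<in> ?P k l" by (auto elim: concE)
        then show ?thesis using concI[OF _ ext[OF _ l], of a "?P p k" b k] by simp
      next
        case 3
        then obtain a b where "w = a @ b" "a \<in> conc (?P p k) (kplus (?P k k))" "b \<in> ?P k l"
          by (auto elim: concE)
        then show ?thesis using concI[OF _ ext[OF _ l], of a "conc (?P p k) (kplus (?P k k))" b k]
          by simp
      qed
    qed
  qed
qed

section \<open>The inductive step on the rank\<close>

context
  fixes n :: nat and Low T :: "'g set"
  defines "Low \<equiv> {g. rank g < n}" and "T \<equiv> {g. rank g = n}"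
  assumes Low_plus: "cov Low W \<Longrightarrow> cov Low (kplus W)"
begin

lemma Low_mul: "x \<in> Low \<Longrightarrow> x \<cdot> y \<in> Low" "y \<in> Low \<Longrightarrow> x \<cdot> y \<in> Low"
  using rank_mul_left[of x y] rank_mul_right[of x y] unfolding Low_def by auto

text \<open>\<open>T\<close> may contain several J-classes; the dichotomy between keeping and losing
  rank is what the construction relies on.\<close>

lemma T_mul: "x \<in> T \<Longrightarrow> x \<cdot> y \<in> T \<union> Low"
  using rank_mul_left[of x y] unfolding Low_def T_def by auto

text \<open>Separates the two iterations. The gain comes when the values of \<open>D\<close> absorb
  those of \<open>kplus V\<close> on their right, since a block of \<open>D\<close> with its tail is
  then no harder than the block alone.\<close>

lemma cov_plus_Un:
  assumes V: "cov R (kplus V)" and X: "cov S (kplus (D \<union> conc D (kplus V)))"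
    and RS: "R \<subseteq> Q" "S \<subseteq> Q" "\<And>r s. r \<in> R \<Longrightarrow> s \<in> S \<Longrightarrow> r \<cdot> s \<in> Q"
  shows "cov Q (kplus (V \<union> D))"
proof -
  let ?X = "D \<union> conc D (kplus V)"
  have "cov Q (kplus V)" "cov Q (kplus ?X)" "cov Q (conc (kplus V) (kplus ?X))"
    using cov_mono[OF V RS(1)] cov_mono[OF X RS(2)] cov_conc[OF V X RS(3)] by auto
  then have "cov Q (kplus V \<union> kplus ?X \<union> conc (kplus V) (kplus ?X))" by (intro cov_Un)
  then show ?thesis using kplus_Un_subset[of V D] by (rule cov_mono[OF _ subset_refl])
qed

text \<open>Blocks bounded by \<open>e\<close> iterate to \<open>sharp e\<close>, which is
  \<open>e\<close> or has lower rank. A block of lower rank absorbs its tail because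
  \<open>Low\<close> is an ideal, and \<open>Low_plus\<close> iterates the result.\<close>

lemma cov_plus_idem:
  assumes e: "e \<cdot> e = e" "e \<in> T" and W: "cov (insert e Low) W"
  shows "cov (insert e Low) (kplus W)"
proof -
  obtain V D where VD: "W = V \<union> D" "cov {e} V" "cov Low D" using W cov_split[of "{e}" Low W] by auto
  have V: "cov (insert e Low) (kplus V)"
    using bd_plus[OF bd_if_cov_singleton[OF VD(2)] e(1)] e(2) sharp_eq_or_rank_less[OF e(1)]
    unfolding Low_def T_def by (intro cov_bd[where g = "sharp e"]) auto
  have "cov Low (kplus (D \<union> conc D (kplus V)))"
    by (intro Low_plus cov_Un VD cov_conc[OF VD(3) V] Low_mul)
  from cov_plus_Un[OF V this] show ?thesis unfolding VD(1) by (auto intro: Low_mul)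
qed

text \<open>Induction on \<open>E\<close>, splitting off one element \<open>x\<close>. By
  \<open>x \<cdot> y = x\<close>, blocks of value \<open>x\<close> keep that value after a tail over
  \<open>E\<close>, unless they fall into \<open>Low\<close>; what remains is to iterate the single
  idempotent \<open>x\<close>.\<close>

lemma cov_plus_band:
  assumes "finite E" "E \<subseteq> T" "\<And>x y. x \<in> E \<Longrightarrow> y \<in> E \<Longrightarrow> x \<cdot> y = x" "cov (E \<union> Low) W"
  shows "cov (E \<union> Low) (kplus W)"
  using assms
proof (induction E arbitrary: W rule: finite_induct)
  case empty
  then show ?case using Low_plus by simp
next
  case (insert x E)
  have xy: "\<And>y. y \<in> insert x E \<Longrightarrow> x \<cdot> y = x" "\<And>y. y \<in> insert x E \<Longrightarrow> y \<cdot> x = y"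
    using insert.prems(2) by auto
  have "cov ((E \<union> Low) \<union> (insert x Low)) W" using insert.prems(3) by (rule cov_mono) auto
  then obtain V D where VD: "W = V \<union> D" "cov (E \<union> Low) V" "cov (insert x Low) D"
    by (rule cov_split)
  have V: "cov (E \<union> Low) (kplus V)" using insert.prems(1,2) by (intro insert.IH VD(2)) auto
  have "cov (insert x Low) (kplus (D \<union> conc D (kplus V)))"
    using insert.prems(1) xy
    by (intro cov_plus_idem cov_Un VD cov_conc[OF VD(3) V]) (auto intro: Low_mul)
  then show ?case unfolding VD(1)
  proof (rule cov_plus_Un[OF V])
    fix r s assume "r \<in> E \<union> Low" "s \<in> insert x Low"
    then show "r \<cdot> s \<in> insert x E \<union> Low" using xy(2)[of r] Low_mul[of _ r] Low_mul[of r s] by auto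
  qed auto
qed

text \<open>Kleene induction on the allowed intermediate states. The sets
  \<open>{g \<in> T. p \<cdot> g = q} \<union> Low\<close> compose along runs, so only the loops at
  the new state need an argument.\<close>

lemma cov_paths:
  assumes U: "\<And>g. bd (U g) g" and "finite K" "K \<subseteq> T"
  shows "cov ({g \<in> T. p \<cdot> g = q} \<union> Low) (paths U T K p q)"
  using assms(2,3)
proof (induction K arbitrary: p q rule: finite_induct)
  case empty
  have "paths U T {} p q \<subseteq> (\<Union>g\<in>{g \<in> T. p \<cdot> g = q} \<union> Low. U g)"
    unfolding paths_def by (auto elim: path.cases)
  then show ?case unfolding cov_def using U by blast
next
  case (insert k K)
  let ?R = "\<lambda>p q. {g \<in> T. p \<cdot> g = q} \<union> Low" and ?P = "paths U T K"
  have IH: "cov (?R p q) (?P p q)" for p q using insert by blast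
  have mul: "r \<cdot> s \<in> ?R x z" if "r \<in> ?R x y" "s \<in> ?R y z" for r s x y z
    using that T_mul[of r s] by (auto intro: Low_mul simp: mul_assoc[symmetric])
  have k: "k \<in> T" using insert.prems by blast
  \<comment> \<open>\<open>k\<close> and the loop values in \<open>T\<close> all have rank
    \<open>n\<close>, as \<open>stabiliser_band\<close> requires; so those values form a
    band.\<close>
  have "cov (?R k k) (kplus (?P k k))"
    using stabiliser_band[of k] k by (intro cov_plus_band IH) (auto simp: T_def)
  then have "cov (?R p q) (?P p q \<union> conc (?P p k) (?P k q) \<union> conc (conc (?P p k) (kplus (?P k k))) (?P k q))"
    by (intro cov_Un IH cov_conc[OF IH IH mul] cov_conc[OF cov_conc[OF IH _ mul] IH mul]) auto
  then show ?case by (rule cov_mono[OF _ subset_refl paths_insert])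
qed

lemma cov_plus_T:
  assumes U: "\<And>g. bd (U g) g"
  shows "cov (T \<union> Low) (kplus (\<Union>g\<in>T. U g))"
proof -
  \<comment> \<open>Words of \<open>S\<close> keep the rank; those of \<open>Z\<close> lose it exactly with their last block. Cutting
    greedily after each loss of rank writes every word as blocks of \<open>Z\<close> followed by a rest in \<open>S\<close>.\<close>
  define S where "S = (\<Union>q\<in>T. paths U T T one q)"
  define Z where "Z = (\<Union>(p,h)\<in>{(p,h). p \<in> T \<and> h \<in> T \<and> p \<cdot> h \<in> Low}. conc (paths U T T one p) (U h))"
  \<comment> \<open>A run started at \<open>one\<close> ends in the product of its blocks, so the
    covering set shrinks to the end state and \<open>Low\<close>.\<close>
  have P: "cov (insert q Low) (paths U T T one q)" for q
    using cov_paths[OF U, of T one q] by (rule cov_mono) (auto simp: one_left)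
  have covS: "cov (T \<union> Low) S" unfolding S_def by (intro cov_UN cov_mono[OF P]) auto
  have "cov Low (conc (paths U T T one p) (U h))" if "p \<cdot> h \<in> Low" for p h
    using that by (intro cov_conc[OF P cov_bd[OF U, of h "{h}"]]) (auto intro: Low_mul)
  then have covZ: "cov Low (kplus Z)" unfolding Z_def by (intro Low_plus cov_UN) auto
  have "cov (T \<union> Low) (S \<union> kplus Z \<union> conc (kplus Z) S)"
    by (intro cov_Un covS cov_mono[OF covZ] cov_conc[OF covZ covS]) (auto intro: Low_mul)
  moreover have "kplus (\<Union>g\<in>T. U g) \<subseteq> S \<union> kplus Z \<union> conc (kplus Z) S"
  proof
    have b: "u \<in> S" if "g \<in> T" "u \<in> U g" for u g
      using path.base[of g T u U T one, OF that] that unfolding paths_def S_def by (auto simp: one_left)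
    have s: "v @ u \<in> S \<union> Z" if v: "v \<in> S" and g: "g \<in> T" "u \<in> U g" for u v g
    proof -
      obtain q where q: "q \<in> T" "path U T T one v q" using v unfolding paths_def S_def by blast
      show ?thesis
      proof (cases "q \<cdot> g \<in> T")
        case True
        then show ?thesis using path.snoc[OF q(2,1) g] True unfolding paths_def S_def by blast
      next
        case False
        then have "q \<cdot> g \<in> Low" using T_mul[OF q(1)] by blast
        moreover have "v @ u \<in> conc (paths U T T one q) (U g)"
          using q g unfolding paths_def by (auto intro: concI)
        ultimately show ?thesis using q(1) g(1) unfolding Z_def by blast
      qed
    qed
    fix w assume "w \<in> kplus (\<Union>g\<in>T. U g)"
    then show "w \<in> S \<union> kplus Z \<union> conc (kplus Z) S"
    proof induction
      case (base w) then show ?case using b by blast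
    next
      case (snoc v u)
      then obtain g where g: "g \<in> T" "u \<in> U g" by blast
      from snoc.IH consider "v \<in> S" | "v \<in> kplus Z" | "v \<in> conc (kplus Z) S" by blast
      then show ?case
      proof cases
        case 1 then show ?thesis using s[OF 1 g] kplus.base by blast
      next
        case 2 then show ?thesis using concI[OF 2 b[OF g]] by blast
      next
        case 3
        then obtain x y where xy: "v = x @ y" "x \<in> kplus Z" "y \<in> S" by (rule concE)
        have "y @ u \<in> S \<union> Z" by (rule s[OF xy(3) g])
        then have "x @ (y @ u) \<in> conc (kplus Z) S \<union> kplus Z"
          using concI[OF xy(2)] kplus.snoc[OF xy(2)] by blast
        then show ?thesis unfolding xy(1) append_assoc by blast
      qed
    qed
  qed
  ultimately show ?thesis by (rule cov_mono[OF _ subset_refl])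
qed

text \<open>The split of \<open>cov_plus_idem\<close> again, with all of \<open>T\<close> in place
  of one idempotent.\<close>

lemma cov_plus_step:
  assumes "cov (T \<union> Low) W"
  shows "cov (T \<union> Low) (kplus W)"
proof -
  obtain V D where VD: "W = V \<union> D" "cov T V" "cov Low D" using assms by (rule cov_split)
  obtain U where U: "\<forall>g. bd (U g) g" "V \<subseteq> (\<Union>g\<in>T. U g)" using VD(2) unfolding cov_def by blast
  have V: "cov (T \<union> Low) (kplus V)"
    using cov_plus_T[of U] U kplus_mono[OF U(2)] by (auto intro: cov_mono)
  have "cov Low (kplus (D \<union> conc D (kplus V)))"
    by (intro Low_plus cov_Un VD cov_conc[OF VD(3) V] Low_mul)
  from cov_plus_Un[OF V this] show ?thesis unfolding VD(1) by (auto intro: Low_mul)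
qed

end

lemma cov_plus_rank: "cov {g. rank g < n} W \<Longrightarrow> cov {g. rank g < n} (kplus W)"
proof (induction n arbitrary: W)
  case 0
  then show ?case using kplus_empty unfolding cov_def by auto
next
  case (Suc n)
  have "{g. rank g < Suc n} = {g. rank g = n} \<union> {g. rank g < n}" by auto
  then show ?case using cov_plus_step[of n W] Suc by simp
qed

lemma cov_plus: "cov UNIV W \<Longrightarrow> cov UNIV (kplus W)"
proof -
  assume "cov UNIV W"
  \<comment> \<open>A rank is at most the size of the monoid; the successor accounts for the strict
    inequality.\<close>
  moreover have "{g. rank g < Suc (CARD('g))} = UNIV"
    unfolding rank_def by (auto simp: less_Suc_eq_le intro: card_mono)
  ultimately show ?thesis using cov_plus_rank[of "Suc (CARD('g))" W] by simp
qed

end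

section \<open>Word matrices and limit-words\<close>

lemma mat_word_Nil: "mat_word Delta [] = mat_one"
  by (simp add: mat_word_def)

lemma mat_word_Cons: "mat_word Delta (a # u) = mat_mult (mat_letter Delta a) (mat_word Delta u)"
  by (simp add: mat_word_def)

lemma mat_mult_assoc: "mat_mult (mat_mult A B) C = mat_mult A (mat_mult B C)"
  unfolding mat_mult_def
  by (intro ext, simp add: sum_distrib_left sum_distrib_right mult.assoc) (rule sum.swap)

lemma mat_one_mult: "mat_mult mat_one A = A"
  unfolding mat_mult_def mat_one_def by (intro ext) (simp add: if_distrib[of "\<lambda>x. x * _"] cong: if_cong)

lemma mat_mult_one: "mat_mult A mat_one = A"
  unfolding mat_mult_def mat_one_def by (intro ext) (simp add: if_distrib[of "\<lambda>x. _ * x"] cong: if_cong)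

lemma mat_word_append: "mat_word Delta (u @ v) = mat_mult (mat_word Delta u) (mat_word Delta v)"
  by (induction u) (simp_all add: mat_word_Nil mat_word_Cons mat_one_mult mat_mult_assoc)

lemma mat_word_single: "mat_word Delta [a] = mat_letter Delta a"
  by (simp add: mat_word_Cons mat_word_Nil mat_mult_one)

lemma mat_word_append_sum:
  "(\<Sum>t\<in>B. mat_word Delta (u @ v) s t) = (\<Sum>q\<in>UNIV. mat_word Delta u s q * (\<Sum>t\<in>B. mat_word Delta v q t))"
  unfolding mat_word_append mat_mult_def sum_distrib_left by (rule sum.swap)

lemma mat_word_nonneg: "0 \<le> mat_word Delta u s t"
  by (induction u arbitrary: s t)
    (auto simp: mat_word_Nil mat_word_Cons mat_one_def mat_mult_def mat_letter_def intro!: sum_nonneg)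

lemma mat_word_sum: "(\<Sum>t\<in>UNIV. mat_word Delta u s t) = 1"
proof (induction u arbitrary: s)
  case Nil
  then show ?case by (simp add: mat_word_Nil mat_one_def)
next
  case (Cons a u)
  have "(\<Sum>q\<in>UNIV. mat_letter Delta a s q) = 1" unfolding mat_letter_def by (simp add: sum_pmf_eq_1)
  then show ?case using mat_word_append_sum[of Delta "[a]" u s UNIV] Cons by (simp add: mat_word_single)
qed

lemma mat_word_sum_le: "(\<Sum>t\<in>B. mat_word Delta u s t) \<le> 1"
  using sum_mono2[of UNIV B "mat_word Delta u s"] mat_word_sum[of Delta u s] mat_word_nonneg by fastforce

lemma mat_word_le_sum: "t \<in> B \<Longrightarrow> mat_word Delta u s t \<le> (\<Sum>t\<in>B. mat_word Delta u s t)"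
  by (rule member_le_sum) (auto simp: mat_word_nonneg)

lemma mat_word_le_1: "mat_word Delta u s t \<le> 1"
  using mat_word_le_sum[of t UNIV Delta u s] mat_word_sum_le[of Delta u s UNIV] by simp

lemma mat_word_sum_Compl: "(\<Sum>t\<in>-B. mat_word Delta u s t) = 1 - (\<Sum>t\<in>B. mat_word Delta u s t)"
  using sum.Int_Diff[of UNIV "mat_word Delta u s" B] mat_word_sum[of Delta u s]
  by (simp add: Compl_eq_Diff_UNIV)

section \<open>Supports of word matrices\<close>

definition supp :: "'q mat \<Rightarrow> 'q lword" where
  "supp M = (\<lambda>s t. 0 < M s t)"

lemma supp_mult:
  assumes "\<And>s t. 0 \<le> A s t" "\<And>s t. 0 \<le> B s t"
  shows "supp (mat_mult A B) = lw_mult (supp A) (supp B)"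
proof (intro ext)
  fix s t
  have "0 < (\<Sum>q\<in>UNIV. A s q * B q t) \<longleftrightarrow> (\<exists>q. 0 < A s q * B q t)"
    using assms by (subst less_le, subst sum_nonneg_eq_0_iff[THEN arg_cong[of _ _ Not], unfolded eq_commute[of _ 0]])
      (auto intro!: sum_nonneg simp: less_le)
  then show "supp (mat_mult A B) s t = lw_mult (supp A) (supp B) s t"
    using assms unfolding supp_def mat_mult_def lw_mult_def by (auto simp: zero_less_mult_iff not_less[symmetric])
qed

lemma supp_append: "supp (mat_word Delta (u @ v)) = lw_mult (supp (mat_word Delta u)) (supp (mat_word Delta v))"
  unfolding mat_word_append by (rule supp_mult) (rule mat_word_nonneg)+

lemma supp_Nil: "supp (mat_word Delta []) = lw_one"
  unfolding supp_def mat_word_Nil mat_one_def lw_one_def by auto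

lemma supp_single: "supp (mat_word Delta [a]) = lw_letter Delta a"
  unfolding supp_def mat_word_single mat_letter_def lw_letter_def by auto

lemma idempotent_mat_iff:
  assumes "\<And>s t. 0 \<le> M s t"
  shows "idempotent_mat M \<longleftrightarrow> lw_idempotent (supp M)"
proof -
  have "lw_mult (supp M) (supp M) = supp (mat_mult M M)" using supp_mult[of M M] assms by simp
  then show ?thesis unfolding idempotent_mat_def lw_idempotent_def
    by (auto simp only: supp_def fun_eq_iff)
qed

section \<open>Idempotent limit-words and recurrence\<close>

lemma lw_trans:
  assumes "lw_idempotent u" "u a b" "u b c"
  shows "u a c"
proof -
  have "lw_mult u u a c" using assms(2,3) unfolding lw_mult_def by blast
  then show ?thesis using assms(1) unfolding lw_idempotent_def by simp
qed

lemma lw_dense: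
  assumes "lw_idempotent u" "u a c"
  shows "\<exists>b. u a b \<and> u b c"
proof -
  have "lw_mult u u a c" using assms unfolding lw_idempotent_def by simp
  then show ?thesis unfolding lw_mult_def .
qed

lemma lw_mult_assoc: "lw_mult (lw_mult a b) c = lw_mult a (lw_mult b c)"
  unfolding lw_mult_def by blast

text \<open>Take a successor \<open>t\<close> of \<open>s\<close> with the fewest successors. By
  minimality every successor of \<open>t\<close> has the same successors as \<open>t\<close>, so
  these form one closed class.\<close>

lemma ex_recurrent:
  fixes u :: "'q::finite lword"
  assumes "lw_idempotent u" "is_limit_word u"
  shows "\<exists>t. u s t \<and> lw_recurrent u t"
proof -
  let ?S = "\<lambda>t. {x. u t x}"
  obtain t where t: "u s t" "\<And>x. u s x \<Longrightarrow> card (?S t) \<le> card (?S x)"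
    using assms(2) ex_has_least_nat[of "u s" _ "\<lambda>t. card (?S t)"] unfolding is_limit_word_def by metis
  have same: "?S x = ?S t" if "u t x" for x
  proof (rule card_seteq)
    show "?S x \<subseteq> ?S t" using lw_trans[OF assms(1) that] by blast
    show "card (?S t) \<le> card (?S x)" using t lw_trans[OF assms(1) t(1) that] by blast
  qed auto
  \<comment> \<open>\<open>t\<close> need not be its own successor and may fail to be recurrent,
    hence one more step.\<close>
  obtain x where x: "u t x" using assms(2) unfolding is_limit_word_def by blast
  have "lw_recurrent u x" unfolding lw_recurrent_def
    using same x lw_trans[OF assms(1) x] by blast
  then show ?thesis using lw_trans[OF assms(1) t(1) x] by blast
qed

lemma is_limit_word_mult: "is_limit_word u \<Longrightarrow> is_limit_word v \<Longrightarrow> is_limit_word (lw_mult u v)"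
  unfolding is_limit_word_def lw_mult_def by blast

lemma ext_markov_monoid_ext_limit_word:
  fixes Delta :: "'q::finite \<Rightarrow> 'a \<Rightarrow> 'q pmf"
  shows "x \<in> ext_markov_monoid Delta \<Longrightarrow> is_ext_limit_word x"
proof (induction rule: ext_markov_monoid.induct)
  case (letter a)
  have "\<exists>t. lw_letter Delta a s t" for s
    unfolding lw_letter_def using set_pmf_not_empty[of "Delta s a"] by (metis pmf_pos set_pmf_iff all_not_in_conv)
  then show ?case by (simp add: is_ext_limit_word_def is_limit_word_def)
next
  case one
  then show ?case by (auto simp: is_ext_limit_word_def is_limit_word_def lw_one_def)
next
  case (mult w v)
  then have "lw_mult (fst w) (fst v) \<le> lw_mult (snd w) (snd v)"
    unfolding is_ext_limit_word_def lw_mult_def le_fun_def le_bool_def by blast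
  then show ?case using mult unfolding is_ext_limit_word_def elw_mult_def by (simp add: is_limit_word_mult)
next
  case (iter w)
  then have "is_limit_word (lw_sharp (fst w))"
    using ex_recurrent[of "fst w"] unfolding is_ext_limit_word_def elw_idempotent_def
    by (simp add: is_limit_word_def lw_sharp_def)
  then show ?case using iter unfolding is_ext_limit_word_def elw_sharp_def by (auto simp: lw_sharp_def)
qed

lemma lw_sharp_left:
  assumes "lw_idempotent u"
  shows "lw_mult u (lw_sharp u) = lw_sharp u"
proof (intro ext iffI)
  fix s t
  show "lw_sharp u s t" if "lw_mult u (lw_sharp u) s t"
    using that lw_trans[OF assms, of s _ t] unfolding lw_mult_def lw_sharp_def by blast
  show "lw_mult u (lw_sharp u) s t" if "lw_sharp u s t"
    using that lw_dense[OF assms, of s t] unfolding lw_mult_def lw_sharp_def by blast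
qed

lemma lw_recurrent_step:
  assumes "lw_idempotent u" "lw_recurrent u s" "u s t"
  shows "lw_recurrent u t"
  using assms(2,3) lw_trans[OF assms(1), of s t] lw_trans[OF assms(1), of _ s t]
  unfolding lw_recurrent_def by blast

text \<open>Totality provides a successor and recurrence leads back from it; without totality a
  state could be recurrent vacuously.\<close>

lemma lw_recurrent_refl:
  assumes "lw_idempotent u" "is_limit_word u" "lw_recurrent u t"
  shows "u t t"
  using assms(2,3) lw_trans[OF assms(1), of t _ t] unfolding lw_recurrent_def is_limit_word_def by blast

lemma lw_sharp_right:
  assumes "lw_idempotent u" "is_limit_word u"
  shows "lw_mult (lw_sharp u) u = lw_sharp u"
proof (intro ext iffI)
  fix s t
  show "lw_sharp u s t" if "lw_mult (lw_sharp u) u s t"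
    using that lw_trans[OF assms(1), of s _ t] lw_recurrent_step[OF assms(1), of _ t]
    unfolding lw_mult_def lw_sharp_def by blast
  show "lw_mult (lw_sharp u) u s t" if "lw_sharp u s t"
    using that lw_recurrent_refl[OF assms, of t] unfolding lw_mult_def lw_sharp_def by blast
qed

lemma lw_sharp_sharp:
  assumes "lw_idempotent u" "is_limit_word u"
  shows "lw_mult (lw_sharp u) (lw_sharp u) = lw_sharp u"
proof (intro ext iffI)
  fix s t
  show "lw_sharp u s t" if "lw_mult (lw_sharp u) (lw_sharp u) s t"
    using that lw_trans[OF assms(1), of s _ t] unfolding lw_mult_def lw_sharp_def by blast
  show "lw_mult (lw_sharp u) (lw_sharp u) s t" if "lw_sharp u s t"
    using that lw_recurrent_refl[OF assms, of t] unfolding lw_mult_def lw_sharp_def by blast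
qed

lemma elw_idempotent_iff: "elw_idempotent e \<longleftrightarrow> elw_mult e e = e"
  unfolding elw_idempotent_def elw_mult_def lw_idempotent_def by (simp add: prod_eq_iff)

section \<open>Uniform lower bounds on words\<close>

definition bounded_by :: "('q::finite \<Rightarrow> 'a \<Rightarrow> 'q pmf) \<Rightarrow> real \<Rightarrow> 'q lword \<times> 'q lword \<Rightarrow> 'a list \<Rightarrow> bool" where
  "bounded_by Delta c x w \<longleftrightarrow> supp (mat_word Delta w) = snd x \<and> (\<forall>s t. fst x s t \<longrightarrow> c \<le> mat_word Delta w s t)"

lemma bounded_by_mono: "bounded_by Delta c x w \<Longrightarrow> d \<le> c \<Longrightarrow> bounded_by Delta d x w"
  unfolding bounded_by_def using order_trans by blast

lemma bounded_by_self: "\<exists>c>0. bounded_by Delta c (supp (mat_word Delta w), supp (mat_word Delta w)) w"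
proof -
  define A where "A = {x \<in> range (\<lambda>(s,t). mat_word Delta w s t). 0 < x}"
  \<comment> \<open>The inserted \<open>1\<close> makes the set visibly nonempty and keeps the
    minimum positive.\<close>
  define c where "c = Min (insert 1 A)"
  have A: "finite (insert 1 A)" unfolding A_def by simp
  have "c \<in> insert 1 A" unfolding c_def by (rule Min_in[OF A]) simp
  then have "0 < c" unfolding A_def by auto
  moreover have "c \<le> mat_word Delta w s t" if "0 < mat_word Delta w s t" for s t
    unfolding c_def using that by (intro Min_le[OF A]) (auto simp: A_def)
  ultimately show ?thesis unfolding bounded_by_def supp_def by auto
qed

lemma mat_word_append_ge:
  "mat_word Delta u s q * mat_word Delta v q t \<le> mat_word Delta (u @ v) s t"
  unfolding mat_word_append mat_mult_def
  by (rule member_le_sum[of q UNIV "\<lambda>q. mat_word Delta u s q * mat_word Delta v q t"])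
    (auto simp: mat_word_nonneg)

lemma bounded_by_append:
  assumes "bounded_by Delta c x u" "bounded_by Delta d y v" "0 < c" "0 < d"
  shows "bounded_by Delta (c * d) (elw_mult x y) (u @ v)"
proof -
  have "c * d \<le> mat_word Delta (u @ v) s t" if "fst x s q" "fst y q t" for s q t
  proof (rule order_trans[OF mult_mono mat_word_append_ge])
    show "c \<le> mat_word Delta u s q" "d \<le> mat_word Delta v q t"
      using assms that unfolding bounded_by_def by auto
  qed (use assms mat_word_nonneg in auto)
  then show ?thesis using assms unfolding bounded_by_def elw_mult_def
    by (auto simp: supp_append lw_mult_def)
qed

text \<open>The covering argument runs over all pairs of relations, a finite type, so membership in
  the extended Markov monoid is carried along here. The empty language is exempt because
  \<open>bd_empty\<close> must hold for every pair.\<close>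

definition bd :: "('q::finite \<Rightarrow> 'a \<Rightarrow> 'q pmf) \<Rightarrow> 'a list set \<Rightarrow> 'q lword \<times> 'q lword \<Rightarrow> bool" where
  "bd Delta W x \<longleftrightarrow> W = {} \<or> x \<in> ext_markov_monoid Delta \<and> (\<exists>c>0. \<forall>w\<in>W. bounded_by Delta c x w)"

lemma supp_kplus:
  assumes "lw_idempotent v" "\<And>w. w \<in> W \<Longrightarrow> supp (mat_word Delta w) = v" "u \<in> kplus W"
  shows "supp (mat_word Delta u) = v"
  using assms(3) by induction (use assms in \<open>auto simp: supp_append lw_idempotent_def\<close>)

text \<open>Absence of a leak witness enters here only. If \<open>t\<close> is recurrent for the first component, the set \<open>D\<close>
  of states reachable from \<open>t\<close> in the second component is never left, and from each of its states \<open>t\<close> is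
  reachable in the first component. So the mass that a first factor brings to \<open>D\<close> survives until
  the last factor, which sends a fraction \<open>c\<close> of it to \<open>t\<close>.\<close>

lemma bounded_by_kplus:
  fixes Delta :: "'q::finite \<Rightarrow> 'a \<Rightarrow> 'q pmf"
  assumes e: "is_ext_limit_word e" "elw_idempotent e" "\<not> leak_witness e"
    and W: "\<And>w. w \<in> W \<Longrightarrow> bounded_by Delta c e w" and c: "0 < c"
    and u: "u \<in> kplus W"
  shows "bounded_by Delta (min c (c * c)) (elw_sharp e) u"
proof -
  note idem = e(2)[unfolded elw_idempotent_def, THEN conjunct1] e(2)[unfolded elw_idempotent_def, THEN conjunct2]
  have lim: "is_limit_word (fst e)" and le: "\<And>s t. fst e s t \<Longrightarrow> snd e s t"
    using e(1) unfolding is_ext_limit_word_def by auto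
  have supp: "supp (mat_word Delta u) = snd e" if "u \<in> kplus W" for u
    using supp_kplus[OF idem(2) _ that] W unfolding bounded_by_def by blast
  \<comment> \<open>The value \<open>c\<close> serves a single factor; \<open>c * c\<close> serves
    two or more, one \<open>c\<close> for entering \<open>D\<close> and one for the last step to
    \<open>t\<close>.\<close>
  have "min c (c * c) \<le> mat_word Delta u s t" if st: "fst e s t" and t: "lw_recurrent (fst e) t" for s t
  proof -
    define D where "D = {q. snd e t q}"
    have tD: "t \<in> D" unfolding D_def using lw_recurrent_refl[OF idem(1) lim t] le by blast
    have stay: "(\<Sum>q'\<in>D. mat_word Delta w q q') = 1" if "w \<in> W" "q \<in> D" for w q
    proof -
      have "mat_word Delta w q q' = 0" if "q' \<notin> D" for q'
      proof -
        have "\<not> snd e q q'" using that \<open>q \<in> D\<close> lw_trans[OF idem(2)] unfolding D_def by blast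
        then have "\<not> supp (mat_word Delta w) q q'" using W[OF \<open>w \<in> W\<close>] unfolding bounded_by_def by simp
        then show ?thesis using mat_word_nonneg[of Delta w q q'] unfolding supp_def by simp
      qed
      then have "(\<Sum>q'\<in>D. mat_word Delta w q q') = (\<Sum>q'\<in>UNIV. mat_word Delta w q q')"
        by (intro sum.mono_neutral_left) auto
      then show ?thesis using mat_word_sum by metis
    qed
    have mass: "c \<le> (\<Sum>q\<in>D. mat_word Delta v s q)" if "v \<in> kplus W" for v
      using that
    proof induction
      case (base w)
      then show ?case using W st mat_word_le_sum[OF tD, of Delta w s] unfolding bounded_by_def by fastforce
    next
      case (snoc v w)
      have "(\<Sum>q\<in>D. mat_word Delta v s q) = (\<Sum>q\<in>D. mat_word Delta v s q * (\<Sum>q'\<in>D. mat_word Delta w q q'))"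
        using stay[OF snoc(2)] by simp
      also have "\<dots> \<le> (\<Sum>q\<in>UNIV. mat_word Delta v s q * (\<Sum>q'\<in>D. mat_word Delta w q q'))"
        by (intro sum_mono2) (auto intro!: mult_nonneg_nonneg sum_nonneg simp: mat_word_nonneg)
      finally show ?case using snoc.IH unfolding mat_word_append_sum by simp
    qed
    have ret: "fst e q t" if q: "q \<in> D" for q
    proof -
      obtain p where p: "fst e q p" "lw_recurrent (fst e) p" using ex_recurrent[OF idem(1) lim] by blast
      have "snd e t p" using lw_trans[OF idem(2)] q le[OF p(1)] unfolding D_def by blast
      \<comment> \<open>Both \<open>t\<close> and \<open>p\<close> are recurrent and
        \<open>snd e t p\<close> holds, so a missing \<open>fst e t p\<close> would make
        \<open>e\<close> a leak witness.\<close>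
      then have "fst e t p" using e t p(2) unfolding leak_witness_def by blast
      then have "fst e p t" using t unfolding lw_recurrent_def by blast
      then show ?thesis using lw_trans[OF idem(1) p(1)] by blast
    qed
    from u show ?thesis
    proof cases
      case base
      then show ?thesis using W[of u] st unfolding bounded_by_def by fastforce
    next
      case (snoc v w)
      have "c * c \<le> (\<Sum>q\<in>D. mat_word Delta v s q) * c" using mass[OF snoc(2)] c by simp
      also have "\<dots> \<le> (\<Sum>q\<in>D. mat_word Delta v s q * mat_word Delta w q t)"
        unfolding sum_distrib_right using W[OF snoc(3)] ret unfolding bounded_by_def
        by (intro sum_mono mult_left_mono) (auto simp: mat_word_nonneg)
      also have "\<dots> \<le> (\<Sum>q\<in>UNIV. mat_word Delta v s q * mat_word Delta w q t)"
        by (intro sum_mono2) (auto simp: mat_word_nonneg)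
      finally show ?thesis unfolding snoc(1) mat_word_append mat_mult_def by simp
    qed
  qed
  then show ?thesis using supp[OF u] unfolding bounded_by_def elw_sharp_def lw_sharp_def by simp
qed

text \<open>The sharp identities fail for some idempotent relations that are not total, such as
  \<open>{(q, q), (q, t)}\<close> with \<open>q \<noteq> t\<close>; the guard makes them hold on the whole type.\<close>

definition guarded_sharp :: "('q::finite) lword \<times> 'q lword \<Rightarrow> 'q lword \<times> 'q lword" where
  "guarded_sharp e = (if is_ext_limit_word e then elw_sharp e else e)"

lemma elw_mult_assoc: "elw_mult (elw_mult x y) z = elw_mult x (elw_mult y z)"
  unfolding elw_mult_def by (simp add: lw_mult_assoc)

lemma stabilisation_cover_bd:
  fixes Delta :: "'q::finite \<Rightarrow> 'a \<Rightarrow> 'q pmf"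
  assumes no_witness: "\<And>x. x \<in> ext_markov_monoid Delta \<Longrightarrow> \<not> leak_witness x"
  shows "stabilisation_cover elw_mult (lw_one, lw_one) guarded_sharp (bd Delta)"
proof
  fix x y z e :: "'q lword \<times> 'q lword" and V W :: "'a list set"
  show "elw_mult (elw_mult x y) z = elw_mult x (elw_mult y z)" by (rule elw_mult_assoc)
  show "elw_mult (lw_one, lw_one) x = x" "elw_mult x (lw_one, lw_one) = x"
    unfolding elw_mult_def lw_mult_def lw_one_def by auto
  show "elw_mult e (guarded_sharp e) = guarded_sharp e"
    "elw_mult (guarded_sharp e) e = guarded_sharp e"
    "elw_mult (guarded_sharp e) (guarded_sharp e) = guarded_sharp e" if e: "elw_mult e e = e"
  proof -
    have i: "lw_idempotent (fst e)" "lw_mult (snd e) (snd e) = snd e"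
      using e elw_idempotent_iff[of e] unfolding elw_idempotent_def lw_idempotent_def by auto
    have "elw_mult e (elw_sharp e) = elw_sharp e \<and> elw_mult (elw_sharp e) e = elw_sharp e \<and>
      elw_mult (elw_sharp e) (elw_sharp e) = elw_sharp e" if "is_limit_word (fst e)"
      using lw_sharp_left[OF i(1)] lw_sharp_right[OF i(1) that] lw_sharp_sharp[OF i(1) that] i(2)
      unfolding elw_mult_def elw_sharp_def by simp
    then show "elw_mult e (guarded_sharp e) = guarded_sharp e"
      "elw_mult (guarded_sharp e) e = guarded_sharp e"
      "elw_mult (guarded_sharp e) (guarded_sharp e) = guarded_sharp e"
      using e unfolding guarded_sharp_def is_ext_limit_word_def by auto
  qed
  show "bd Delta {} x" unfolding bd_def by simp
  show "bd Delta V x" if "V \<subseteq> W" "bd Delta W x" using that unfolding bd_def by blast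
  show "bd Delta (V \<union> W) x" if VW: "bd Delta V x" "bd Delta W x"
  proof (cases "V = {} \<or> W = {}")
    case True then show ?thesis using VW by auto
  next
    case False
    then obtain c d where "0 < c" "\<forall>w\<in>V. bounded_by Delta c x w" "0 < d" "\<forall>w\<in>W. bounded_by Delta d x w"
      "x \<in> ext_markov_monoid Delta" using VW unfolding bd_def by auto
    moreover from this have "bounded_by Delta (min c d) x w" if "w \<in> V \<union> W" for w
      using that bounded_by_mono[of Delta c x w "min c d"] bounded_by_mono[of Delta d x w "min c d"] by auto
    ultimately have "\<forall>w\<in>V\<union>W. bounded_by Delta (min c d) x w" "0 < min c d" "x \<in> ext_markov_monoid Delta"
      by auto
    then show ?thesis unfolding bd_def by blast
  qed
  show "bd Delta (conc V W) (elw_mult x y)" if VW: "bd Delta V x" "bd Delta W y"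
  proof (cases "V = {} \<or> W = {}")
    case True then show ?thesis unfolding bd_def conc_def by auto
  next
    case False
    then obtain c d where cd: "0 < c" "\<forall>w\<in>V. bounded_by Delta c x w" "0 < d" "\<forall>w\<in>W. bounded_by Delta d y w"
      "x \<in> ext_markov_monoid Delta" "y \<in> ext_markov_monoid Delta" using VW unfolding bd_def by auto
    have "\<forall>w\<in>conc V W. bounded_by Delta (c * d) (elw_mult x y) w"
    proof
      fix w assume "w \<in> conc V W"
      then obtain u v where "w = u @ v" "u \<in> V" "v \<in> W" by (rule concE)
      then show "bounded_by Delta (c * d) (elw_mult x y) w"
        using bounded_by_append[OF _ _ cd(1,3), of Delta x u y v] cd(2,4) by simp
    qed
    moreover have "0 < c * d" "elw_mult x y \<in> ext_markov_monoid Delta"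
      using cd by (auto intro: ext_markov_monoid.mult)
    ultimately show ?thesis unfolding bd_def by blast
  qed
  show "bd Delta (kplus W) (guarded_sharp e)" if W: "bd Delta W e" and e: "elw_mult e e = e"
  proof (cases "W = {}")
    case True then show ?thesis unfolding bd_def by (simp add: kplus_empty)
  next
    case False
    then obtain c where c: "0 < c" "\<And>w. w \<in> W \<Longrightarrow> bounded_by Delta c e w" "e \<in> ext_markov_monoid Delta"
      using W unfolding bd_def by auto
    have i: "elw_idempotent e" using e elw_idempotent_iff by blast
    have l: "is_ext_limit_word e" by (rule ext_markov_monoid_ext_limit_word[OF c(3)])
    have "\<forall>w\<in>kplus W. bounded_by Delta (min c (c * c)) (elw_sharp e) w"
      using bounded_by_kplus[OF l i no_witness[OF c(3)] c(2,1)] by blast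
    moreover have "0 < min c (c * c)" using c(1) by simp
    moreover have "elw_sharp e \<in> ext_markov_monoid Delta" by (rule ext_markov_monoid.iter[OF c(3) i])
    ultimately have "bd Delta (kplus W) (elw_sharp e)" unfolding bd_def by blast
    then show ?thesis using l unfolding guarded_sharp_def by simp
  qed
qed

text \<open>Each letter is bounded by its own generator; finiteness of the alphabet joins these
  coverings, \<open>cov_plus\<close> reaches all nonempty words, and the unit covers the empty
  word.\<close>

lemma words_covered:
  fixes Delta :: "'q::finite \<Rightarrow> 'a::finite \<Rightarrow> 'q pmf"
  assumes no_witness: "\<And>x. x \<in> ext_markov_monoid Delta \<Longrightarrow> \<not> leak_witness x"
  shows "\<exists>U. (\<forall>x. bd Delta (U x) x) \<and> (\<forall>w. \<exists>x. w \<in> U x)"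
proof -
  interpret stabilisation_cover elw_mult "(lw_one, lw_one)" guarded_sharp "bd Delta"
    using stabilisation_cover_bd[OF no_witness] .
  have "cov UNIV {[a]}" for a
  proof (rule cov_bd)
    show "bd Delta {[a]} (lw_letter Delta a, lw_letter Delta a)"
      using bounded_by_self[of Delta "[a]"] unfolding bd_def supp_single
      by (auto intro: ext_markov_monoid.letter)
  qed simp
  then have "cov UNIV (\<Union>a\<in>UNIV. {[a]})" by (intro cov_UN) auto
  then have "cov UNIV (kplus (\<Union>a\<in>UNIV. {[a]}))" by (rule cov_plus)
  moreover have "cov UNIV {[]}"
  proof (rule cov_bd)
    show "bd Delta {[]} (lw_one, lw_one)"
      using bounded_by_self[of Delta "[]"] unfolding bd_def supp_Nil
      by (auto intro: ext_markov_monoid.one)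
  qed simp
  ultimately have "cov UNIV (kplus (\<Union>a\<in>UNIV. {[a]}) \<union> {[]})" by (rule cov_Un)
  then obtain U where U: "\<forall>x. bd Delta (U x) x" "kplus (\<Union>a\<in>UNIV. {[a]}) \<union> {[]} \<subseteq> (\<Union>x\<in>UNIV. U x)"
    unfolding cov_def by blast
  have all: "w \<in> kplus (\<Union>a\<in>UNIV. {[a]}) \<union> {[]}" for w :: "'a list"
  proof (induction w rule: rev_induct)
    case (snoc a w)
    have a: "[a] \<in> (\<Union>a\<in>UNIV. {[a]})" by blast
    show ?case
    proof (cases "w = []")
      case True then show ?thesis using kplus.base[OF a] by simp
    next
      case False then show ?thesis using snoc kplus.snoc[OF _ a] by blast
    qed
  qed simp
  have "\<exists>x. w \<in> U x" for w using subsetD[OF U(2) all] by simp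
  with U(1) show ?thesis by blast
qed

text \<open>The predicate \<open>P\<close> transports to the idempotent power whatever is stable
  under right multiplication by \<open>x\<close>.\<close>

lemma ex_idempotent_power:
  fixes x :: "('q::finite) lword \<times> 'q lword"
  assumes x: "P x" and step: "\<And>y. P y \<Longrightarrow> P (elw_mult y x)"
  shows "\<exists>e. P e \<and> elw_idempotent e"
proof -
  define p where "p i = ((\<lambda>y. elw_mult y x) ^^ i) x" for i
  have p0: "p 0 = x" and pS: "p (Suc i) = elw_mult (p i) x" for i unfolding p_def by auto
  have add: "elw_mult (p i) (p j) = p (Suc (i + j))" for i j
    by (induction j) (auto simp: p0 pS elw_mult_assoc[symmetric])
  have P: "P (p i)" for i by (induction i) (auto simp: p0 pS x step)
  have "\<not> inj p" using finite_imageD[of p UNIV] by auto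
  then obtain i j where ij: "i < j" "p i = p j" unfolding inj_def by (metis nat_neq_iff)
  define d where "d = j - i"
  have per: "p (i + a + k * d) = p (i + a)" for a k
  proof (induction k)
    case (Suc k)
    have shift: "p (i + b + d) = p (i + b)" for b
    proof (induction b)
      case 0 then show ?case using ij unfolding d_def by simp
    next
      case (Suc b) then show ?case using pS[of "i + b"] pS[of "i + b + d"] by simp
    qed
    show ?case using shift[of "a + k * d"] Suc by (simp add: algebra_simps)
  qed simp
  \<comment> \<open>\<open>p m\<close> is the power \<open>m + 1\<close> of \<open>x\<close>. The
    choice gives \<open>m \<ge> i\<close>, so periodicity applies, and makes \<open>Suc m\<close>,
    the index shift caused by squaring, a multiple of the period \<open>d\<close>.\<close>
  define m where "m = i + (d * Suc i - 1 - i)"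
  have d: "d \<ge> 1" unfolding d_def using ij by simp
  then have "d * Suc i \<ge> Suc i" using mult_le_mono1[of 1 d "Suc i"] by simp
  then have m: "Suc m = Suc i * d" unfolding m_def by (simp add: mult.commute)
  have "elw_mult (p m) (p m) = p (m + Suc m)" using add by simp
  also have "\<dots> = p m" unfolding m using per[of "d * Suc i - 1 - i" "Suc i"] unfolding m_def by simp
  finally show ?thesis using P elw_idempotent_iff by blast
qed

section \<open>Leaks and leak witnesses\<close>

lemma leak_imp_witness:
  fixes Delta :: "'q::finite \<Rightarrow> 'a::finite \<Rightarrow> 'q pmf"
  assumes "is_leak Delta us"
  shows "\<exists>x \<in> ext_markov_monoid Delta. leak_witness x"
proof (rule ccontr)
  assume none: "\<not> ?thesis"
  then have "\<exists>U. (\<forall>x. bd Delta (U x) x) \<and> (\<forall>w. \<exists>x. w \<in> U x)" by (intro words_covered) blast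
  then obtain U where U: "\<And>x. bd Delta (U x) x" "\<And>w. \<exists>x. w \<in> U x" by blast
  obtain M r q where us: "\<And>n. idempotent_word Delta (us n)"
    and lim: "\<And>s t. (\<lambda>n. mat_word Delta (us n) s t) \<longlonglongrightarrow> M s t"
    and M: "idempotent_mat M" "mc_recurrent M r" "mc_recurrent M q"
    and rq: "(\<lambda>n. prob_path Delta r (us n) q) \<longlonglongrightarrow> 0" "\<And>n. prob_path Delta r (us n) q > 0"
    using assms unfolding is_leak_def mat_tendsto_def by blast
  have "\<forall>n. \<exists>x. us n \<in> U x" using U(2) by (intro allI)
  then have "\<exists>f. \<forall>n. us n \<in> U (f n)" by (rule choice)
  then obtain f where f: "\<And>n. us n \<in> U (f n)" by (elim exE) auto
  have "finite (range f)" by (rule finite_subset[OF subset_UNIV finite])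
  then obtain n1 where "infinite {n. f n = f n1}"
    using pigeonhole_infinite[of "UNIV :: nat set" f] by auto
  moreover define x where "x = f n1"
  ultimately have "infinite {n. f n = x}" by simp
  then have inf: "\<exists>n\<ge>N. f n = x" for N by (auto simp: infinite_nat_iff_unbounded_le)
  have "U x \<noteq> {}" using inf[of 0] f by blast
  then obtain c where x: "x \<in> ext_markov_monoid Delta" and c: "0 < c" "\<And>w. w \<in> U x \<Longrightarrow> bounded_by Delta c x w"
    using U(1)[of x] unfolding bd_def by blast
  have often: "\<exists>n\<ge>N. bounded_by Delta c x (us n)" for N using inf[of N] f c(2) by metis
  have nonneg: "0 \<le> M s t" for s t
    by (rule LIMSEQ_le_const[OF lim]) (auto simp: mat_word_nonneg)
  have Mi: "lw_idempotent (supp M)" using M(1) idempotent_mat_iff[of M] nonneg by blast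
  \<comment> \<open>Such an entry is at least \<open>c\<close> at infinitely many indices, so its
    limit cannot lie below \<open>c\<close>.\<close>
  have sub: "supp M s t" if st: "fst x s t" for s t
  proof (rule ccontr)
    assume "\<not> supp M s t"
    then have "M s t < c" using c(1) unfolding supp_def by simp
    then obtain N where "\<forall>n\<ge>N. mat_word Delta (us n) s t < c"
      using order_tendstoD(2)[OF lim[of s t]] unfolding eventually_sequentially by blast
    then show False using often[of N] st unfolding bounded_by_def by fastforce
  qed
  \<comment> \<open>A positive limit makes the entry positive eventually, in particular at some
    index bounded by \<open>x\<close>, where the support is \<open>snd x\<close>.\<close>
  have sup: "snd x s t" if st: "supp M s t" for s t
  proof -
    obtain N where "\<forall>n\<ge>N. 0 < mat_word Delta (us n) s t"
      using order_tendstoD(1)[OF lim[of s t]] st unfolding supp_def eventually_sequentially by blast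
    then obtain n where "bounded_by Delta c x (us n)" "0 < mat_word Delta (us n) s t" using often[of N] by blast
    then show ?thesis unfolding bounded_by_def supp_def by (metis)
  qed
  obtain n0 where n0: "bounded_by Delta c x (us n0)" using often by blast
  then have snd0: "supp (mat_word Delta (us n0)) = snd x" unfolding bounded_by_def by blast
  have xi: "lw_idempotent (snd x)"
    using us[of n0] idempotent_mat_iff[of "mat_word Delta (us n0)"] mat_word_nonneg
    unfolding idempotent_word_def snd0 by blast
  have "snd x r q" using rq(2)[of n0] snd0 unfolding prob_path_def supp_def by metis
  have "M r q = 0" using LIMSEQ_unique[OF lim[of r q]] rq(1) unfolding prob_path_def by blast
  \<comment> \<open>These properties survive powers of \<open>x\<close>: \<open>snd x\<close> is
    idempotent, and \<open>supp M\<close> is transitive.\<close>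
  let ?P = "\<lambda>y. y \<in> ext_markov_monoid Delta \<and> snd y = snd x \<and> fst y \<le> supp M"
  have "?P x" using x sub by (simp add: le_fun_def)
  moreover have "?P (elw_mult y x)" if "?P y" for y
  proof -
    have "lw_mult (fst y) (fst x) \<le> supp M"
      using that sub lw_trans[OF Mi] unfolding lw_mult_def le_fun_def le_bool_def by blast
    moreover have "elw_mult y x \<in> ext_markov_monoid Delta" using that x by (intro ext_markov_monoid.mult) auto
    ultimately show ?thesis using that xi unfolding lw_idempotent_def by (simp add: elw_mult_def)
  qed
  ultimately obtain e where e: "e \<in> ext_markov_monoid Delta" "snd e = snd x" "\<And>s t. fst e s t \<Longrightarrow> supp M s t"
      "elw_idempotent e"
    using ex_idempotent_power[of ?P x] unfolding le_fun_def le_bool_def by blast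
  have el: "is_ext_limit_word e" by (rule ext_markov_monoid_ext_limit_word[OF e(1)])
  \<comment> \<open>A recurrent state of \<open>M\<close> need not be recurrent for
    \<open>fst e\<close>, but some \<open>fst e\<close>-successor is, and it lies in the same class
    of \<open>M\<close>.\<close>
  have rec: "\<exists>t. lw_recurrent (fst e) t \<and> supp M s t \<and> supp M t s" if "mc_recurrent M s" for s
  proof -
    obtain t where t: "fst e s t" "lw_recurrent (fst e) t"
      using ex_recurrent[of "fst e" s] e(4) el unfolding elw_idempotent_def is_ext_limit_word_def by blast
    have st: "supp M s t" using e(3)[OF t(1)] .
    then have "(s, t) \<in> mc_reach M" unfolding mc_reach_def supp_def by auto
    then have "(t, s) \<in> {(s, t). supp M s t}\<^sup>*" using that unfolding mc_recurrent_def mc_reach_def supp_def by blast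
    then have "t = s \<or> supp M t s"
    proof (induction rule: rtrancl_induct)
      case (step y z)
      then show ?case using lw_trans[OF Mi, of t y z] by blast
    qed simp
    then show ?thesis using st t(2) by blast
  qed
  obtain r' where r': "lw_recurrent (fst e) r'" "supp M r r'" "supp M r' r" using rec[OF M(2)] by blast
  obtain q' where q': "lw_recurrent (fst e) q'" "supp M q q'" "supp M q' q" using rec[OF M(3)] by blast
  \<comment> \<open>Otherwise \<open>r\<close>, \<open>r'\<close>, \<open>q'\<close>,
    \<open>q\<close> would be a path in \<open>supp M\<close>. In \<open>snd x\<close>, conversely,
    \<open>r'\<close>, \<open>r\<close>, \<open>q\<close>, \<open>q'\<close> is a path.\<close>
  have "\<not> fst e r' q'"
  proof
    assume "fst e r' q'"
    then have "supp M r q" using e(3) lw_trans[OF Mi] r'(2) q'(3) by metis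
    then show False using \<open>M r q = 0\<close> unfolding supp_def by simp
  qed
  moreover have "snd e r' q'" unfolding e(2)
    using sup[OF r'(3)] \<open>snd x r q\<close> sup[OF q'(2)] lw_trans[OF xi] by metis
  ultimately have "leak_witness e" using e(4) el r'(1) q'(1) unfolding leak_witness_def by blast
  then show False using none e(1) by blast
qed

section \<open>Words approximating an element of the monoid\<close>

definition approximates ::
    "('q::finite \<Rightarrow> 'a \<Rightarrow> 'q pmf) \<Rightarrow> real \<Rightarrow> real \<Rightarrow> 'q lword \<times> 'q lword \<Rightarrow> 'a list \<Rightarrow> bool" where
  "approximates Delta c \<epsilon> x w \<longleftrightarrow>
    bounded_by Delta c x w \<and> (\<forall>s t. \<not> fst x s t \<longrightarrow> mat_word Delta w s t \<le> \<epsilon>)"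

lemma approximates_append:
  fixes Delta :: "'q::finite \<Rightarrow> 'a \<Rightarrow> 'q pmf"
  assumes u: "approximates Delta c \<epsilon> x u" "0 < c" and v: "approximates Delta d \<epsilon> y v" "0 < d"
    and "0 \<le> \<epsilon>"
  shows "approximates Delta (c * d) (real CARD('q) * \<epsilon>) (elw_mult x y) (u @ v)"
proof -
  have "mat_word Delta (u @ v) s t \<le> real CARD('q) * \<epsilon>" if st: "\<not> fst (elw_mult x y) s t" for s t
  proof -
    have "mat_word Delta u s q * mat_word Delta v q t \<le> \<epsilon>" for q
    proof (cases "fst x s q")
      case True
      then have "mat_word Delta v q t \<le> \<epsilon>"
        using st v unfolding approximates_def elw_mult_def by (auto simp: lw_mult_def)
      then have "mat_word Delta u s q * mat_word Delta v q t \<le> 1 * \<epsilon>"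
        by (intro mult_mono mat_word_le_1 mat_word_nonneg) auto
      then show ?thesis by simp
    next
      case False
      then have "mat_word Delta u s q * mat_word Delta v q t \<le> \<epsilon> * 1"
        using u \<open>0 \<le> \<epsilon>\<close> by (intro mult_mono mat_word_le_1 mat_word_nonneg) (auto simp: approximates_def)
      then show ?thesis by simp
    qed
    then have "(\<Sum>q\<in>UNIV. mat_word Delta u s q * mat_word Delta v q t) \<le> real CARD('q) * \<epsilon>"
      by (intro sum_bounded_above) auto
    then show ?thesis unfolding mat_word_append mat_mult_def .
  qed
  then show ?thesis
    using bounded_by_append[of Delta c x u d y v] u v unfolding approximates_def by blast
qed

text \<open>Condition on the state between the two factors: \<open>\<alpha>\<close> bounds the
  chance of landing in \<open>B\<close> from inside \<open>A\<close>, \<open>\<beta>\<close> from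
  outside.\<close>

lemma mass_append_le:
  assumes A: "\<And>q. q \<in> A \<Longrightarrow> (\<Sum>t\<in>B. mat_word Delta v q t) \<le> \<alpha>"
    and C: "\<And>q. q \<notin> A \<Longrightarrow> (\<Sum>t\<in>B. mat_word Delta v q t) \<le> \<beta>"
  shows "(\<Sum>t\<in>B. mat_word Delta (u @ v) s t)
    \<le> \<alpha> * (\<Sum>t\<in>A. mat_word Delta u s t) + \<beta> * (\<Sum>t\<in>-A. mat_word Delta u s t)"
proof -
  let ?f = "\<lambda>q. mat_word Delta u s q * (\<Sum>t\<in>B. mat_word Delta v q t)"
  have "(\<Sum>t\<in>B. mat_word Delta (u @ v) s t) = sum ?f A + sum ?f (-A)"
    unfolding mat_word_append_sum using sum.Int_Diff[of UNIV ?f A] by (simp add: Compl_eq_Diff_UNIV)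
  also have "\<dots> \<le> (\<Sum>q\<in>A. mat_word Delta u s q * \<alpha>) + (\<Sum>q\<in>-A. mat_word Delta u s q * \<beta>)"
    using A C by (intro add_mono sum_mono mult_left_mono) (auto simp: mat_word_nonneg)
  finally show ?thesis by (simp add: sum_distrib_left mult.commute)
qed

text \<open>The exponent is shifted: \<open>wpow w j\<close> consists of \<open>j + 1\<close> copies
  of \<open>w\<close>.\<close>

fun wpow :: "'a list \<Rightarrow> nat \<Rightarrow> 'a list" where
  "wpow w 0 = w"
| "wpow w (Suc j) = wpow w j @ w"

lemma wpow_in_kplus: "wpow w j \<in> kplus {w}"
  by (induction j) (auto intro: kplus.intros)

text \<open>Per copy of \<open>w\<close>, at most \<open>\<eta>\<close> of the mass at a state moves
  along pairs outside \<open>fst e\<close>, and \<open>2 + j\<close> copies are read. Up to this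
  leakage, closed sets keep their mass and the transient mass shrinks by the factor
  \<open>1 - c\<close>.\<close>

lemma approximates_wpow:
  fixes Delta :: "'q::finite \<Rightarrow> 'a \<Rightarrow> 'q pmf"
  assumes e: "is_ext_limit_word e" "elw_idempotent e"
    and w: "approximates Delta c \<delta> e w" and c: "0 < c" "c \<le> 1" and "0 \<le> \<delta>"
    and \<eta>: "\<eta> = real CARD('q) * \<delta>"
    and small: "(2 + real j) * \<eta> \<le> c / 2" "(1 - c) ^ Suc j + (2 + real j) * \<eta> \<le> \<epsilon>"
  shows "approximates Delta (c * c / 2) \<epsilon> (elw_sharp e) (wpow w (Suc j))"
proof -
  let ?P = "\<lambda>i. mat_word Delta (wpow w i)" and ?W = "mat_word Delta w"
  define u where "u = fst e"
  have idem: "lw_idempotent u" "lw_idempotent (snd e)" using e(2) unfolding u_def elw_idempotent_def by auto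
  have lim: "is_limit_word u" using e(1) unfolding u_def is_ext_limit_word_def by blast
  have lower: "c \<le> ?W s t" if "u s t" for s t
    using w that unfolding approximates_def bounded_by_def u_def by blast
  have upper: "?W s t \<le> \<delta>" if "\<not> u s t" for s t using w that unfolding approximates_def u_def by blast
  have \<eta>0: "0 \<le> \<eta>" using \<eta> \<open>0 \<le> \<delta>\<close> by simp
  have leave: "(\<Sum>t\<in>B. ?W q t) \<le> \<eta>" if "\<And>t. t \<in> B \<Longrightarrow> \<not> u q t" for q B
  proof -
    have "(\<Sum>t\<in>B. ?W q t) \<le> real (card B) * \<delta>" by (rule sum_bounded_above) (use that upper in auto)
    also have "\<dots> \<le> \<eta>" unfolding \<eta> using \<open>0 \<le> \<delta>\<close> by (intro mult_right_mono) (auto intro: card_mono)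
    finally show ?thesis .
  qed
  have closed: "(\<Sum>t\<in>-C. ?P i s t) \<le> (\<Sum>t\<in>-C. ?W s t) + i * \<eta>"
    if C: "\<And>q t. q \<in> C \<Longrightarrow> u q t \<Longrightarrow> t \<in> C" for C s i
  proof (induction i)
    case (Suc i)
    have "(\<Sum>t\<in>-C. ?P (Suc i) s t) \<le> \<eta> * (\<Sum>t\<in>C. ?P i s t) + 1 * (\<Sum>t\<in>-C. ?P i s t)"
      unfolding wpow.simps
    proof (rule mass_append_le)
      show "(\<Sum>t\<in>-C. ?W q t) \<le> \<eta>" if "q \<in> C" for q using C[OF that] by (intro leave) blast
      show "(\<Sum>t\<in>-C. ?W q t) \<le> 1" for q by (rule mat_word_sum_le)
    qed
    also have "\<dots> \<le> \<eta> * 1 + 1 * (\<Sum>t\<in>-C. ?P i s t)"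
      by (intro add_mono mult_left_mono mat_word_sum_le \<eta>0) auto
    finally show ?case using Suc by (simp add: algebra_simps)
  qed simp
  \<comment> \<open>The first copy is estimated by the trivial bound 1, so the exponent is one less
    than the number of copies.\<close>
  have trans: "(\<Sum>t\<in>{t. \<not> lw_recurrent u t}. ?P i s t) \<le> (1 - c) ^ i + i * \<eta>" for s i
  proof (induction i)
    case 0
    then show ?case using mat_word_sum_le by simp
  next
    case (Suc i)
    let ?T = "{t. \<not> lw_recurrent u t}"
    have "(\<Sum>t\<in>?T. ?P (Suc i) s t) \<le> (1 - c) * (\<Sum>t\<in>?T. ?P i s t) + \<eta> * (\<Sum>t\<in>-?T. ?P i s t)"
      unfolding wpow.simps
    proof (rule mass_append_le)
      fix q
      obtain t where t: "u q t" "lw_recurrent u t" using ex_recurrent[OF idem(1) lim] by blast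
      have "c \<le> (\<Sum>t\<in>-?T. ?W q t)" using lower[OF t(1)] mat_word_le_sum[of t "-?T" Delta w q] t(2) by simp
      then show "(\<Sum>t\<in>?T. ?W q t) \<le> 1 - c" using mat_word_sum_Compl[of Delta w q ?T] by linarith
      assume "q \<notin> ?T"
      then show "(\<Sum>t\<in>?T. ?W q t) \<le> \<eta>" using lw_recurrent_step[OF idem(1)] by (intro leave) auto
    qed
    also have "\<dots> \<le> (1 - c) * ((1 - c) ^ i + i * \<eta>) + \<eta> * 1"
      using c by (intro add_mono mult_left_mono mat_word_sum_le \<eta>0 Suc) auto
    also have "\<dots> = (1 - c) ^ Suc i + Suc i * \<eta> - c * (i * \<eta>)" by (simp add: algebra_simps)
    also have "\<dots> \<le> (1 - c) ^ Suc i + Suc i * \<eta>" using c \<eta>0 by simp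
    finally show ?case .
  qed
  have "c * c / 2 \<le> ?P (Suc j) s t" if st: "u s t" "lw_recurrent u t" for s t
  proof -
    \<comment> \<open>The class of \<open>t\<close>, which is closed. The first copy brings mass
      \<open>c\<close> into it, at most \<open>c / 2\<close> leaks out before the last copy, and
      that copy sends a fraction \<open>c\<close> to \<open>t\<close>; hence
      \<open>c * c / 2\<close>.\<close>
    define C where "C = {q. u t q}"
    have tC: "t \<in> C" unfolding C_def using lw_recurrent_refl[OF idem(1) lim st(2)] by simp
    have "(\<Sum>q\<in>-C. ?P j s q) \<le> (\<Sum>q\<in>-C. ?W s q) + j * \<eta>"
      by (rule closed) (use lw_trans[OF idem(1)] in \<open>auto simp: C_def\<close>)
    moreover have "c \<le> (\<Sum>q\<in>C. ?W s q)" using lower[OF st(1)] mat_word_le_sum[OF tC, of Delta w s] by simp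
    ultimately have "c - j * \<eta> \<le> (\<Sum>q\<in>C. ?P j s q)"
      using mat_word_sum_Compl[of Delta w s C] mat_word_sum_Compl[of Delta "wpow w j" s C] by linarith
    moreover have "j * \<eta> \<le> c / 2" using small(1) \<eta>0 by (simp add: algebra_simps)
    ultimately have "c / 2 \<le> (\<Sum>q\<in>C. ?P j s q)" by linarith
    then have "c / 2 * c \<le> (\<Sum>q\<in>C. ?P j s q) * c" using c(1) by (intro mult_right_mono) auto
    also have "\<dots> \<le> (\<Sum>q\<in>C. ?P j s q * ?W q t)" unfolding sum_distrib_right
      using st(2) lower by (intro sum_mono mult_left_mono) (auto simp: C_def lw_recurrent_def mat_word_nonneg)
    also have "\<dots> \<le> (\<Sum>q\<in>UNIV. ?P j s q * ?W q t)" by (intro sum_mono2) (auto simp: mat_word_nonneg)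
    finally show ?thesis unfolding wpow.simps mat_word_append mat_mult_def by simp
  qed
  \<comment> \<open>Either \<open>t\<close> is transient and its mass has decayed, or
    \<open>t\<close> lies outside the closed set of successors of \<open>s\<close> and is reached
    only by leakage.\<close>
  moreover have "?P (Suc j) s t \<le> \<epsilon>" if "\<not> (u s t \<and> lw_recurrent u t)" for s t
  proof (cases "u s t")
    case True
    then have "?P (Suc j) s t \<le> (\<Sum>t\<in>{t. \<not> lw_recurrent u t}. ?P (Suc j) s t)"
      using that by (intro mat_word_le_sum) auto
    also note trans
    finally show ?thesis using small(2) \<eta>0 by (simp add: algebra_simps)
  next
    case False
    then have "?P (Suc j) s t \<le> (\<Sum>t\<in>-{t. u s t}. ?P (Suc j) s t)" by (intro mat_word_le_sum) auto
    also have "\<dots> \<le> (\<Sum>t\<in>-{t. u s t}. ?W s t) + Suc j * \<eta>"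
      by (rule closed) (use lw_trans[OF idem(1)] in auto)
    also have "\<dots> \<le> \<eta> + Suc j * \<eta>" using leave[of "-{t. u s t}" s] by simp
    finally have "?P (Suc j) s t \<le> (2 + real j) * \<eta>" by (simp add: algebra_simps)
    moreover have "0 \<le> (1 - c) ^ Suc j" using c by (intro zero_le_power) simp
    ultimately show ?thesis using small(2) by linarith
  qed
  moreover have "supp (?P (Suc j)) = snd e"
    using w by (intro supp_kplus[OF idem(2) _ wpow_in_kplus]) (auto simp: approximates_def bounded_by_def)
  ultimately show ?thesis
    unfolding approximates_def bounded_by_def elw_sharp_def lw_sharp_def u_def by simp
qed

text \<open>Choosing \<open>c\<close> before \<open>\<epsilon>\<close> is essential: for an
  iteration the error of the inner word must be small relative to \<open>c\<close> and to the number
  of copies, without changing \<open>c\<close>.\<close>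

lemma ex_approximates:
  fixes Delta :: "'q::finite \<Rightarrow> 'a \<Rightarrow> 'q pmf"
  assumes "x \<in> ext_markov_monoid Delta"
  shows "\<exists>c>0. \<forall>\<epsilon>>0. \<exists>w. approximates Delta c \<epsilon> x w"
  using assms
proof induction
  case (letter a)
  obtain c where c: "0 < c" "bounded_by Delta c (lw_letter Delta a, lw_letter Delta a) [a]"
    using bounded_by_self[of Delta "[a]"] unfolding supp_single by blast
  have "mat_word Delta [a] s t \<le> 0" if "\<not> lw_letter Delta a s t" for s t
    using that supp_single[of Delta a] unfolding supp_def by (metis not_less)
  then have "approximates Delta c \<epsilon> (lw_letter Delta a, lw_letter Delta a) [a]" if "0 < \<epsilon>" for \<epsilon>
    using c(2) that unfolding approximates_def by (force intro: order_trans)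
  then show ?case using c(1) by blast
next
  case one
  obtain c where c: "0 < c" "bounded_by Delta c (lw_one, lw_one) []"
    using bounded_by_self[of Delta "[]"] unfolding supp_Nil by blast
  have "mat_word Delta [] s t \<le> 0" if "\<not> lw_one s t" for s t
    using that supp_Nil[of Delta] unfolding supp_def by (metis not_less)
  then have "approximates Delta c \<epsilon> (lw_one, lw_one) []" if "0 < \<epsilon>" for \<epsilon>
    using c(2) that unfolding approximates_def by (force intro: order_trans)
  then show ?case using c(1) by blast
next
  case (mult x y)
  obtain c where c: "0 < c" "\<And>\<epsilon>. 0 < \<epsilon> \<Longrightarrow> \<exists>w. approximates Delta c \<epsilon> x w" using mult.IH(1) by blast
  obtain d where d: "0 < d" "\<And>\<epsilon>. 0 < \<epsilon> \<Longrightarrow> \<exists>w. approximates Delta d \<epsilon> y w" using mult.IH(2) by blast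
  have "\<exists>w. approximates Delta (c * d) \<epsilon> (elw_mult x y) w" if "0 < \<epsilon>" for \<epsilon>
  proof -
    \<comment> \<open>Concatenation sums the error over \<open>CARD('q)\<close> intermediate
      states.\<close>
    have pos: "0 < \<epsilon> / CARD('q)" using that by simp
    obtain u v where "approximates Delta c (\<epsilon> / CARD('q)) x u" "approximates Delta d (\<epsilon> / CARD('q)) y v"
      using c(2)[OF pos] d(2)[OF pos] by blast
    from approximates_append[OF this(1) c(1) this(2) d(1)] show ?thesis using pos by auto
  qed
  then show ?case using c(1) d(1) by (intro exI[of _ "c * d"]) simp
next
  case (iter e)
  obtain c where c: "0 < c" "\<And>\<epsilon>. 0 < \<epsilon> \<Longrightarrow> \<exists>w. approximates Delta c \<epsilon> e w" using iter.IH by blast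
  have lim: "is_ext_limit_word e" by (rule ext_markov_monoid_ext_limit_word[OF iter.hyps(1)])
  \<comment> \<open>By totality each row of \<open>fst e\<close> contains a pair, whose probability
    lies between \<open>c\<close> and 1; \<open>undefined\<close> is just some state.\<close>
  have c1: "c \<le> 1"
  proof -
    obtain t where "fst e undefined t" using lim unfolding is_ext_limit_word_def is_limit_word_def by blast
    moreover obtain w where "approximates Delta c 1 e w" using c(2)[of 1] by auto
    ultimately have "c \<le> mat_word Delta w undefined t" unfolding approximates_def bounded_by_def by blast
    then show ?thesis using mat_word_le_1 order_trans by blast
  qed
  have "\<exists>w. approximates Delta (c * c / 2) \<epsilon> (elw_sharp e) w" if "0 < \<epsilon>" for \<epsilon>
  proof -
    obtain i where i: "(1 - c) ^ i < \<epsilon> / 2" using real_arch_pow_inv[of "\<epsilon> / 2" "1 - c"] c c1 \<open>0 < \<epsilon>\<close> by auto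
    have "(1 - c) ^ Suc i \<le> (1 - c) ^ i" using c(1) c1 by (intro power_decreasing) auto
    then have i': "(1 - c) ^ Suc i \<le> \<epsilon> / 2" using i by linarith
    \<comment> \<open>The number of copies is fixed first, to make the transient mass at most
      \<open>\<epsilon> / 2\<close>; only then is the leakage chosen, with total at most
      \<open>c / 2\<close> and \<open>\<epsilon> / 2\<close>.\<close>
    define \<eta> where "\<eta> = min (c / 2) (\<epsilon> / 2) / (2 + real i)"
    have \<eta>: "(2 + real i) * \<eta> = min (c / 2) (\<epsilon> / 2)" unfolding \<eta>_def by simp
    have "0 < \<eta>" unfolding \<eta>_def using c(1) \<open>0 < \<epsilon>\<close> by simp
    then obtain w where w: "approximates Delta c (\<eta> / CARD('q)) e w" using c(2)[of "\<eta> / CARD('q)"] by auto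
    have "approximates Delta (c * c / 2) \<epsilon> (elw_sharp e) (wpow w (Suc i))"
    proof (rule approximates_wpow[OF lim iter.hyps(2) w c(1) c1])
      show "0 \<le> \<eta> / CARD('q)" "\<eta> = real CARD('q) * (\<eta> / CARD('q))" using \<open>0 < \<eta>\<close> by simp_all
      show "(2 + real i) * \<eta> \<le> c / 2" "(1 - c) ^ Suc i + (2 + real i) * \<eta> \<le> \<epsilon>"
        using i' unfolding \<eta> by linarith+
    qed
    then show ?thesis by blast
  qed
  then show ?case using c(1) by (intro exI[of _ "c * c / 2"]) simp
qed

text \<open>Bolzano-Weierstrass, with a matrix read as a vector indexed by pairs of states.\<close>

lemma convergent_subsequence_mat:
  fixes A :: "nat \<Rightarrow> ('q::finite) mat"
  assumes "\<And>n s t. \<bar>A n s t\<bar> \<le> 1"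
  shows "\<exists>f M. strict_mono f \<and> mat_tendsto (A \<circ> f) M"
proof -
  define v :: "nat \<Rightarrow> real ^ ('q \<times> 'q)" where "v n = (\<chi> p. A n (fst p) (snd p))" for n
  have "norm (v n) \<le> real (CARD('q \<times> 'q))" for n
  proof -
    have "norm (v n) \<le> (\<Sum>p\<in>UNIV. \<bar>v n $ p\<bar>)" by (rule norm_le_l1_cart)
    also have "\<dots> \<le> (\<Sum>p\<in>(UNIV::('q \<times> 'q) set). 1)" by (intro sum_mono) (simp add: v_def assms)
    finally show ?thesis by simp
  qed
  then have "bounded (range v)" unfolding bounded_iff by blast
  then obtain l f where f: "strict_mono f" "(v \<circ> f) \<longlonglongrightarrow> l"
    using bounded_imp_convergent_subsequence by blast
  have "(\<lambda>n. (A \<circ> f) n s t) \<longlonglongrightarrow> l $ (s, t)" for s t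
    using tendsto_vec_nth[OF f(2), of "(s, t)"] by (simp add: v_def o_def)
  then have "mat_tendsto (A \<circ> f) (\<lambda>s t. l $ (s, t))" unfolding mat_tendsto_def by blast
  then show ?thesis using f(1) by blast
qed

lemma witness_imp_leak:
  fixes Delta :: "'q::finite \<Rightarrow> 'a \<Rightarrow> 'q pmf"
  assumes x: "x \<in> ext_markov_monoid Delta" and wit: "leak_witness x"
  shows "\<exists>us. is_leak Delta us"
proof -
  obtain r q where idem: "lw_idempotent (fst x)" "lw_idempotent (snd x)"
    and rq: "lw_recurrent (fst x) r" "lw_recurrent (fst x) q" "\<not> fst x r q" "snd x r q"
    using wit unfolding leak_witness_def elw_idempotent_def by blast
  obtain c where c: "0 < c" "\<And>\<epsilon>. 0 < \<epsilon> \<Longrightarrow> \<exists>w. approximates Delta c \<epsilon> x w"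
    using ex_approximates[OF x] by blast
  have "\<exists>w. approximates Delta c (1 / Suc n) x w" for n by (rule c(2)) simp
  then obtain ws where ws: "\<And>n. approximates Delta c (1 / Suc n) x (ws n)" by metis
  obtain f M where f: "strict_mono f" and "mat_tendsto ((\<lambda>n. mat_word Delta (ws n)) \<circ> f) M"
    using convergent_subsequence_mat[of "\<lambda>n. mat_word Delta (ws n)"]
    by (auto simp: mat_word_nonneg mat_word_le_1)
  define us where "us n = ws (f n)" for n
  have lim: "\<And>s t. (\<lambda>n. mat_word Delta (us n) s t) \<longlonglongrightarrow> M s t"
    using \<open>mat_tendsto _ M\<close> unfolding mat_tendsto_def us_def by simp
  \<comment> \<open>The error bound survives the passage to the subsequence because
    \<open>f n \<ge> n\<close>.\<close>
  have us: "approximates Delta c (1 / Suc n) x (us n)" for n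
  proof -
    have "1 / real (Suc (f n)) \<le> 1 / real (Suc n)" using seq_suble[OF f, of n] by (intro divide_left_mono) auto
    then show ?thesis using ws[of "f n"] unfolding us_def approximates_def by (meson order_trans)
  qed
  have suppu: "supp (mat_word Delta (us n)) = snd x" for n
    using us unfolding approximates_def bounded_by_def by blast
  have nonneg: "0 \<le> M s t" for s t by (rule LIMSEQ_le_const[OF lim]) (auto simp: mat_word_nonneg)
  \<comment> \<open>Vanishing errors here and the fixed lower bound \<open>c\<close> in
    \<open>pos\<close> make the support of the limit exactly \<open>fst x\<close>.\<close>
  have zero: "M s t = 0" if "\<not> fst x s t" for s t
  proof -
    have "M s t \<le> 0"
      by (rule LIMSEQ_le[OF lim LIMSEQ_inverse_real_of_nat])
        (use us that in \<open>auto simp: approximates_def inverse_eq_divide\<close>)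
    then show ?thesis using nonneg[of s t] by simp
  qed
  have pos: "0 < M s t" if "fst x s t" for s t
  proof -
    have "c \<le> M s t"
      by (rule LIMSEQ_le_const[OF lim]) (use us that in \<open>auto simp: approximates_def bounded_by_def\<close>)
    then show ?thesis using c(1) by simp
  qed
  have suppM: "0 < M s t \<longleftrightarrow> fst x s t" for s t using zero pos by fastforce
  then have sM: "supp M = fst x" unfolding supp_def by blast
  \<comment> \<open>Since \<open>fst x\<close> is transitive, reachability in the chain of
    \<open>M\<close> is equality or a single step.\<close>
  have rec: "mc_recurrent M s" if s: "lw_recurrent (fst x) s" for s
    unfolding mc_recurrent_def mc_reach_def suppM
  proof (intro allI impI)
    fix t assume "(s, t) \<in> {(s, t). fst x s t}\<^sup>*"
    then have "t = s \<or> fst x s t"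
      by (induction rule: rtrancl_induct) (use lw_trans[OF idem(1)] in blast)+
    then show "(t, s) \<in> {(s, t). fst x s t}\<^sup>*" using s unfolding lw_recurrent_def by blast
  qed
  have "idempotent_word Delta (us n)" for n
    unfolding idempotent_word_def using idem(2) suppu[of n] mat_word_nonneg
      idempotent_mat_iff[of "mat_word Delta (us n)"] by metis
  moreover have "mat_tendsto (\<lambda>n. mat_word Delta (us n)) M" unfolding mat_tendsto_def using lim by blast
  moreover have "idempotent_mat M" using idempotent_mat_iff[of M] nonneg idem(1) sM by metis
  moreover have "(\<lambda>n. prob_path Delta r (us n) q) \<longlonglongrightarrow> 0"
    unfolding prob_path_def using lim[of r q] zero[OF rq(3)] by simp
  moreover have "prob_path Delta r (us n) q > 0" for n
  proof -
    have "supp (mat_word Delta (us n)) r q" using suppu rq(4) by simp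
    then show ?thesis unfolding prob_path_def supp_def .
  qed
  ultimately have "is_leak Delta us" unfolding is_leak_def using rec rq(1,2) by blast
  then show ?thesis by blast
qed

theorem theorem4p1:
  fixes Delta :: "'q::finite \<Rightarrow> 'a::finite \<Rightarrow> 'q pmf"
  shows "leaktight Delta \<longleftrightarrow> \<not> (\<exists>w \<in> ext_markov_monoid Delta. leak_witness w)"
  unfolding leaktight_def using leak_imp_witness witness_imp_leak by blast

end
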